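(* Let $P\subset\mathbb{R}^3$ be a generic simple convex polytope with $\mathcal{N}(P)<10$. Then the outer normal fan of $P$ yields a tiling of the sphere $S^2$ into skew spherical triangles; that is, the intersections with $S^2$ of the outer normal cones of the vertices of $P$ are all skew triangles (and they tile $S^2$).
   Context: Polytopes are compact, convex, with non-empty interior. For $y\in\mathrm{Int}\,P$, a normal to $\partial P$ emanating from $y$ is a segment $yz$ such that some support plane $h$ of $P$ satisfies $z\in h\cap P$ and $yz\perp h$. $n(P,y)$ is the number of normals emanating from $y$, and $\mathcal{N}(P)=\max_{y\in\mathrm{Int}\,P}n(P,y)$. $P\subset\mathbb{R}^3$ is simple if each vertex has exactly three emanating edges. The outer normal cone of a vertex $V$ is $\{x\in\mathbb{R}^3:\langle p-V,x\rangle\le 0\ \forall p\in P\}$. Active regions and sheets: for a face $F$ of $P$ (vertex, edge or facet), let $o$ be a point in the relative interior of $F$ and $\mathrm{Cone}(F)=\{x\in\mathbb{R}^3:\langle p-o,x\rangle\ge0\ \forall p\in P\}$ (independent of $o$). The active region of $F$ is $\mathcal{AR}(F)=(\mathrm{Cone}(F)+F)\cap P$. The bifurcation set $\mathcal{B}(P)$ is the union of the boundaries of all active regions. Its linear pieces not lying on $\partial P$ are called sheets: the blue sheets are the side walls of the active regions of facets (i.e. for an edge $E$ of a facet $F$, the set $(E+\mathrm{Cone}(F))\cap P$), and the red sheets are the walls of the active regions of vertices (i.e. for an endpoint $V$ of an edge $E$, the set $(V+\mathrm{Cone}(E))\cap P$). A simple polytope $P\subset\mathbb{R}^3$ is generic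 if (i) no dihedral angle at an edge and no planar angle of a facet (angle of a facet at a vertex) is right, and (ii) the sheets of $\mathcal{B}(P)$ intersect (pairwise) transversally. Spherical triangles: a spherical triangle is a triangle with geodesic edges in the standard unit sphere $S^2$ contained in an open hemisphere. $|XY|$ is spherical distance. A point $X\in S^2$ projects to a geodesic segment $s$ if $s$ and $X$ fit in an open hemisphere and $s$ contains a point $W$ such that the geodesic segment $XW$ is orthogonal to $s$ and $|XW|$ is the distance from $X$ to $s$. A spherical triangle $ABC$ is nice if there is a point $X$ in its interior such that (a) $X$ projects to all three edges of the triangle, and (b) $|XA|<\pi/2$, $|XB|<\pi/2$, $|XC|<\pi/2$. Otherwise it is called skew. *)

theory Defs
  imports "HOL-Analysis.Analysis"
begin

section \<open>Polytopes and normals\<close>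

definition full_polytope :: "(real^3) set \<Rightarrow> bool" where
  "full_polytope P \<longleftrightarrow> polytope P \<and> interior P \<noteq> {}"

definition simple_polytope :: "(real^3) set \<Rightarrow> bool" where
  "simple_polytope P \<longleftrightarrow>
     full_polytope P \<and> (\<forall>V. V extreme_point_of P \<longrightarrow> card {E. E edge_of P \<and> V \<in> E} = 3)"

definition support_plane :: "(real^3) set \<Rightarrow> (real^3) set \<Rightarrow> bool" where
  "support_plane P h \<longleftrightarrow>
     (\<exists>a b. a \<noteq> 0 \<and> h = {x. a \<bullet> x = b} \<and> P \<subseteq> {x. a \<bullet> x \<le> b} \<and> h \<inter> P \<noteq> {})"

definition normals :: "(real^3) set \<Rightarrow> real^3 \<Rightarrow> (real^3) set set" where
  "normals P y =
     {closed_segment y z | z.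
        \<exists>h. support_plane P h \<and> z \<in> h \<inter> P \<and> (\<forall>u\<in>h. \<forall>v\<in>h. orthogonal (z - y) (u - v))}"

definition num_normals :: "(real^3) set \<Rightarrow> real^3 \<Rightarrow> nat" where
  "num_normals P y = card (normals P y)"

text \<open>
  For a polytope, each face contains at most one foot of a normal from \<open>y\<close> in its relative
  interior (the orthogonal projection of \<open>y\<close> to the affine hull of the face). Hence \<open>card\<close> above
  is applied to finite sets, and the values are bounded by the number of faces, so that the
  maximum below exists.
\<close>
definition max_normals :: "(real^3) set \<Rightarrow> nat" where
  "max_normals P = Max (num_normals P ` interior P)"

definition outer_normal_cone :: "(real^3) set \<Rightarrow> real^3 \<Rightarrow> (real^3) set" where
  "outer_normal_cone P V = {x. \<forall>p\<in>P. (p - V) \<bullet> x \<le> 0}"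

section \<open>Genericity\<close>

definition vec_angle :: "real^3 \<Rightarrow> real^3 \<Rightarrow> real" where
  "vec_angle u v = arccos (u \<bullet> v / (norm u * norm v))"

text \<open>
  The dihedral angle at an edge \<open>E\<close> is the angle between vectors \<open>u\<close>, \<open>v\<close> that are orthogonal to \<open>E\<close>
  and point from a relative interior point of \<open>E\<close> into the two facets containing \<open>E\<close>.
\<close>
definition dihedral_angles :: "(real^3) set \<Rightarrow> real set" where
  "dihedral_angles P =
     {vec_angle u v | u v. \<exists>E F G q.
        E edge_of P \<and> F facet_of P \<and> G facet_of P \<and> F \<noteq> G \<and> E \<subseteq> F \<and> E \<subseteq> G \<and>
        q \<in> rel_interior E \<and> u \<noteq> 0 \<and> v \<noteq> 0 \<and> q + u \<in> F \<and> q + v \<in> G \<and>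
        (\<forall>x\<in>E. \<forall>y\<in>E. orthogonal u (x - y) \<and> orthogonal v (x - y))}"

definition planar_angles :: "(real^3) set \<Rightarrow> real set" where
  "planar_angles P =
     {vec_angle (x - V) (y - V) | x y V. \<exists>F D E.
        V extreme_point_of P \<and> F facet_of P \<and> D edge_of P \<and> E edge_of P \<and> D \<noteq> E \<and>
        D \<subseteq> F \<and> E \<subseteq> F \<and> V \<in> D \<and> V \<in> E \<and> x \<in> D - {V} \<and> y \<in> E - {V}}"

definition face_cone :: "(real^3) set \<Rightarrow> (real^3) set \<Rightarrow> (real^3) set" where
  "face_cone P F = {x. \<exists>q\<in>rel_interior F. \<forall>p\<in>P. 0 \<le> (p - q) \<bullet> x}"

lemma face_cone_independent:
  assumes F: "F \<subseteq> P" and q: "q \<in> rel_interior F"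
  shows "face_cone P F = {x. \<forall>p\<in>P. 0 \<le> (p - q) \<bullet> x}"
proof -
  have *: "(r - s) \<bullet> x = 0"
    if r: "r \<in> rel_interior F" and s: "s \<in> rel_interior F" and ge0: "\<forall>p\<in>P. 0 \<le> (p - r) \<bullet> x" for r s x
  proof -
    have rF: "r \<in> F" and sF: "s \<in> F"
      using r s rel_interior_subset by blast+
    have ge: "0 \<le> (s - r) \<bullet> x"
      using ge0 sF F by blast
    obtain e where e: "e > 0" "cball r e \<inter> affine hull F \<subseteq> F"
      using r by (auto simp: mem_rel_interior_cball)
    define t where "t = e / (1 + norm (r - s))"
    have pos: "0 < 1 + norm (r - s)"
      by (rule add_pos_nonneg) auto
    have t: "t > 0" "t * norm (r - s) \<le> e"
      using e(1) pos by (simp_all add: t_def pos_divide_le_eq mult_left_mono)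
    have "r + t *\<^sub>R (r - s) = (1 + t) *\<^sub>R r + (- t) *\<^sub>R s"
      by (simp add: algebra_simps)
    moreover have "\<dots> \<in> affine hull F"
      using rF sF by (intro mem_affine[OF affine_affine_hull]) (auto intro: hull_inc)
    moreover have "r + t *\<^sub>R (r - s) \<in> cball r e"
      using t by (simp add: dist_norm)
    ultimately have "r + t *\<^sub>R (r - s) \<in> P"
      using e(2) F by auto
    then have "0 \<le> ((r + t *\<^sub>R (r - s)) - r) \<bullet> x"
      using ge0 by blast
    then have "0 \<le> t * ((r - s) \<bullet> x)"
      by simp
    then have "0 \<le> (r - s) \<bullet> x"
      using t(1) by (simp add: zero_le_mult_iff)
    with ge show ?thesis
      by (simp add: inner_diff_left)
  qed
  have eq: "(p - q) \<bullet> x = (p - r) \<bullet> x"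
    if "r \<in> rel_interior F" "\<forall>p\<in>P. 0 \<le> (p - r) \<bullet> x" for r p x
    using *[OF that(1) q that(2)] by (simp add: inner_diff_left)
  show ?thesis
    unfolding face_cone_def
  proof (intro Collect_cong iffI)
    fix x
    assume "\<exists>r\<in>rel_interior F. \<forall>p\<in>P. 0 \<le> (p - r) \<bullet> x"
    then obtain r where r: "r \<in> rel_interior F" "\<forall>p\<in>P. 0 \<le> (p - r) \<bullet> x"
      by blast
    show "\<forall>p\<in>P. 0 \<le> (p - q) \<bullet> x"
      unfolding eq[OF r] by (rule r(2))
  next
    fix x
    assume "\<forall>p\<in>P. 0 \<le> (p - q) \<bullet> x"
    then show "\<exists>r\<in>rel_interior F. \<forall>p\<in>P. 0 \<le> (p - r) \<bullet> x"
      using q by blast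
  qed
qed

text \<open>
  \<open>face_sum P G F\<close> is the set \<open>(G + Cone F) \<inter> P\<close>. In particular,
  \<open>face_sum P F F\<close> is the active region of the face \<open>F\<close>. The walls of active regions, which make up
  the bifurcation set, are of the same form with \<open>G\<close> a facet of \<open>F\<close>.
\<close>
definition face_sum :: "(real^3) set \<Rightarrow> (real^3) set \<Rightarrow> (real^3) set \<Rightarrow> (real^3) set" where
  "face_sum P G F = {g + c | g c. g \<in> G \<and> c \<in> face_cone P F} \<inter> P"

text \<open>
  Index pairs of the sheets: the blue sheets \<open>(E + Cone F) \<inter> P\<close> for an edge \<open>E\<close> of a facet \<open>F\<close> and
  the red sheets \<open>(V + Cone E) \<inter> P\<close> for an endpoint \<open>V\<close> of an edge \<open>E\<close>. Walls that degenerate into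
  the boundary of \<open>P\<close> are not sheets. The sheets are treated as an indexed family, so that two
  coinciding sheets with different indices count as a non-transversal pair.
\<close>
definition blue_index :: "(real^3) set \<Rightarrow> ((real^3) set \<times> (real^3) set) set" where
  "blue_index P = {(E, F). E edge_of P \<and> F facet_of P \<and> E \<subseteq> F \<and> \<not> face_sum P E F \<subseteq> frontier P}"

definition red_index :: "(real^3) set \<Rightarrow> ((real^3) set \<times> (real^3) set) set" where
  "red_index P =
     {({V}, E) | V E. V extreme_point_of P \<and> E edge_of P \<and> V \<in> E \<and> \<not> face_sum P {V} E \<subseteq> frontier P}"

text \<open>
  Planar pieces are transversal if at every common point their tangent spaces (here: the direction
  spaces of their affine hulls) together span the whole space.
\<close>
definition transversal :: "(real^3) set \<Rightarrow> (real^3) set \<Rightarrow> bool" where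
  "transversal S T \<longleftrightarrow>
     S \<inter> T = {} \<or>
     span ({x - y | x y. x \<in> S \<and> y \<in> S} \<union> {x - y | x y. x \<in> T \<and> y \<in> T}) = UNIV"

definition generic_polytope :: "(real^3) set \<Rightarrow> bool" where
  "generic_polytope P \<longleftrightarrow>
     pi / 2 \<notin> dihedral_angles P \<and> pi / 2 \<notin> planar_angles P \<and>
     pairwise (\<lambda>(G, F) (G', F'). transversal (face_sum P G F) (face_sum P G' F'))
       (blue_index P \<union> red_index P)"

section \<open>Spherical triangles\<close>

abbreviation S2 :: "(real^3) set" where
  "S2 \<equiv> sphere 0 1"

definition sdist :: "real^3 \<Rightarrow> real^3 \<Rightarrow> real" where
  "sdist X Y = arccos (X \<bullet> Y)"

definition in_open_hemisphere :: "(real^3) set \<Rightarrow> bool" where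
  "in_open_hemisphere S \<longleftrightarrow> (\<exists>h\<in>S2. S \<subseteq> {x \<in> S2. 0 < h \<bullet> x})"

text \<open>The shorter great circle arc; only meaningful for points that are not antipodal.\<close>
definition geodesic_segment :: "real^3 \<Rightarrow> real^3 \<Rightarrow> (real^3) set" where
  "geodesic_segment X Y = S2 \<inter> convex_cone hull {X, Y}"

definition sph_triangle :: "real^3 \<Rightarrow> real^3 \<Rightarrow> real^3 \<Rightarrow> (real^3) set" where
  "sph_triangle A B C = S2 \<inter> convex_cone hull {A, B, C}"

text \<open>Linear independence says that the vertices do not lie on a common great circle.\<close>
definition is_sph_triangle :: "real^3 \<Rightarrow> real^3 \<Rightarrow> real^3 \<Rightarrow> bool" where
  "is_sph_triangle A B C \<longleftrightarrow>
     A \<in> S2 \<and> B \<in> S2 \<and> C \<in> S2 \<and> card {A, B, C} = 3 \<and> independent {A, B, C} \<and>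
     in_open_hemisphere (sph_triangle A B C)"

abbreviation sph_interior :: "(real^3) set \<Rightarrow> (real^3) set" where
  "sph_interior T \<equiv> top_of_set S2 interior_of T"

text \<open>The initial direction at \<open>W\<close> of the geodesic from \<open>W\<close> to \<open>Z\<close>, up to a positive factor.\<close>
definition geodesic_dir :: "real^3 \<Rightarrow> real^3 \<Rightarrow> real^3" where
  "geodesic_dir W Z = Z - (W \<bullet> Z) *\<^sub>R W"

definition projects_to :: "real^3 \<Rightarrow> (real^3) set \<Rightarrow> bool" where
  "projects_to X s \<longleftrightarrow>
     in_open_hemisphere (insert X s) \<and>
     (\<exists>W\<in>s. (\<forall>Z\<in>s. orthogonal (geodesic_dir W X) (geodesic_dir W Z)) \<and>
            sdist X W = (INF Z\<in>s. sdist X Z))"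

definition nice :: "real^3 \<Rightarrow> real^3 \<Rightarrow> real^3 \<Rightarrow> bool" where
  "nice A B C \<longleftrightarrow>
     (\<exists>X \<in> sph_interior (sph_triangle A B C).
        projects_to X (geodesic_segment A B) \<and>
        projects_to X (geodesic_segment B C) \<and>
        projects_to X (geodesic_segment C A) \<and>
        sdist X A < pi / 2 \<and> sdist X B < pi / 2 \<and> sdist X C < pi / 2)"

definition skew_sph_triangle :: "(real^3) set \<Rightarrow> bool" where
  "skew_sph_triangle T \<longleftrightarrow>
     (\<exists>A B C. is_sph_triangle A B C \<and> T = sph_triangle A B C \<and> \<not> nice A B C)"

definition tiles_sphere :: "'i set \<Rightarrow> ('i \<Rightarrow> (real^3) set) \<Rightarrow> bool" where
  "tiles_sphere I T \<longleftrightarrow>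
     finite I \<and> (\<Union>i\<in>I. T i) = S2 \<and> disjoint_family_on (\<lambda>i. sph_interior (T i)) I"

end

theory Submission
  imports Defs
begin

text \<open>
  Write a simple polytope as \<open>{z. \<forall>n\<in>N. n \<bullet> z \<le> b n}\<close>. For generic \<open>y\<close>, the normals from \<open>y\<close>
  correspond to the nonempty sets \<open>S\<close> of facet normals such that \<open>y\<close> lies in the active region of
  the face \<open>S\<close>, that is, the multipliers of \<open>S\<close> and the slacks of \<open>N - S\<close> at the foot are all
  positive. When one of these variables, say for \<open>i\<close>, passes through 0, then \<open>S\<close> and its neighbour
  \<open>toggle i S\<close> appear or disappear together. So the parity of the number of active sets is constant
  along a generic line; on the line \<open>V - t X\<close> with \<open>X\<close> inside the normal cone of the vertex \<open>V\<close>
  it is odd, since only \<open>V\<close> is left for large \<open>t\<close>.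

  If \<open>X\<close> witnesses that the triangle of \<open>V\<close> is nice, then for small \<open>t\<close> all 8 subsets of the facet
  normals at \<open>V\<close> are active (\<open>{}\<close> stands for \<open>P\<close> itself), and so is the vertex \<open>U\<close> farthest from
  \<open>V\<close>. The first of these 9 sets to become inactive disappears together with a neighbour. This
  neighbour is not among the 9: an edge at \<open>V\<close> could only vanish together with \<open>U\<close> if the foot
  of \<open>V - t X\<close> on this edge were \<open>U\<close>, but \<open>P\<close> lies in the ball around \<open>V\<close> through \<open>U\<close>. So there are
  10, hence by parity at least 11 active sets, and removing \<open>{}\<close> leaves 10 normals.
\<close>

section \<open>Feet of perpendiculars and complementary variables\<close>

text \<open>For independent \<open>S\<close> these vectors are the basis of \<open>span S\<close>
  dual to \<open>S\<close>. Confining them to \<open>span S\<close> makes them unique.\<close>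

definition dual_vec :: "'a::euclidean_space set \<Rightarrow> 'a \<Rightarrow> 'a" where
  "dual_vec S x = (SOME d. d \<in> span S \<and> (\<forall>y\<in>S. d \<bullet> y = (if y = x then 1 else 0)))"

text \<open>As in Gram-Schmidt, the component \<open>w\<close> of \<open>x\<close> orthogonal to the
  span of the other vectors is nonzero by independence, and dividing it by
  \<open>w \<bullet> w\<close> gives the required inner products.\<close>

lemma dual_vec:
  fixes S :: "'a::euclidean_space set"
  assumes "independent S" "x \<in> S"
  shows "dual_vec S x \<in> span S" "\<And>y. y \<in> S \<Longrightarrow> dual_vec S x \<bullet> y = (if y = x then 1 else 0)"
proof -
  obtain u w where u: "u \<in> span (S - {x})" and w: "\<And>v. v \<in> span (S - {x}) \<Longrightarrow> orthogonal w v"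
    and x: "x = u + w"
    using orthogonal_subspace_decomp_exists[of "S - {x}" x] by metis
  have xn: "x \<notin> span (S - {x})"
    using assms unfolding dependent_def by blast
  then have "w \<noteq> 0"
    using u x by auto
  then have ww: "w \<bullet> w > 0"
    by simp
  have wx: "w \<bullet> x = w \<bullet> w"
    using w[OF u] by (simp add: x inner_add_right orthogonal_def)
  have "w = x - u"
    using x by simp
  moreover have "u \<in> span S"
    using u span_mono[of "S - {x}" S] by blast
  ultimately have "w \<in> span S"
    using assms(2) by (simp add: span_base span_diff)
  moreover have "w \<bullet> y = 0" if "y \<in> S" "y \<noteq> x" for y
    using w[of y] that by (simp add: orthogonal_def span_base)
  ultimately have "\<exists>d. d \<in> span S \<and> (\<forall>y\<in>S. d \<bullet> y = (if y = x then 1 else 0))"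
    using ww wx by (intro exI[of _ "(1 / (w \<bullet> w)) *\<^sub>R w"]) (auto intro: span_scale)
  from someI_ex[OF this] show "dual_vec S x \<in> span S"
    "\<And>y. y \<in> S \<Longrightarrow> dual_vec S x \<bullet> y = (if y = x then 1 else 0)"
    unfolding dual_vec_def by blast+
qed

lemma sum_mult_dual_vec:
  fixes S :: "'a::euclidean_space set"
  assumes S: "independent S" and x: "x \<in> S"
  shows "(\<Sum>m\<in>S. l m * (dual_vec S x \<bullet> m)) = l x"
proof -
  have "(\<Sum>m\<in>S. l m * (dual_vec S x \<bullet> m)) = (\<Sum>m\<in>S. if m = x then l m else 0)"
    by (intro sum.cong refl) (simp add: dual_vec(2)[OF S x])
  then show ?thesis
    using independent_imp_finite[OF S] x by simp
qed

lemma dual_vec_expansion: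
  fixes S :: "'a::euclidean_space set"
  assumes "independent S" "v \<in> span S"
  shows "(\<Sum>x\<in>S. (dual_vec S x \<bullet> v) *\<^sub>R x) = v"
proof -
  have fin: "finite S"
    using assms(1) by (rule independent_imp_finite)
  then obtain c where v: "v = (\<Sum>x\<in>S. c x *\<^sub>R x)"
    using assms(2) by (auto simp: span_finite)
  have "dual_vec S x \<bullet> v = c x" if "x \<in> S" for x
    using sum_mult_dual_vec[OF assms(1) that] by (simp add: v inner_sum_right)
  then show ?thesis
    using v by simp
qed

lemma span_orthogonal_eq_0:
  fixes v :: "'a::euclidean_space"
  assumes "v \<in> span S" "\<And>x. x \<in> S \<Longrightarrow> x \<bullet> v = 0"
  shows "v = 0"
proof -
  have "orthogonal v v"
    using assms by (intro orthogonal_to_span[of v S v]) (auto simp: orthogonal_def inner_commute)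
  then show ?thesis
    by (simp add: orthogonal_def)
qed

text \<open>For independent \<open>S\<close> this is the orthogonal projection of \<open>y\<close>
  to the affine subspace on which all constraints of \<open>S\<close> hold with equality.\<close>

definition foot :: "('a::euclidean_space \<Rightarrow> real) \<Rightarrow> 'a set \<Rightarrow> 'a \<Rightarrow> 'a" where
  "foot b S y = y + (\<Sum>n\<in>S. (b n - n \<bullet> y) *\<^sub>R dual_vec S n)"

text \<open>The Karush-Kuhn-Tucker system of the distance from \<open>y\<close> on \<open>{z. \<forall>n. n \<bullet> z \<le> b n}\<close> with active
  set \<open>S\<close> has a multiplier for each \<open>n \<in> S\<close> and a slack for each \<open>n \<notin> S\<close>; \<open>cvar\<close> treats both
  uniformly as complementary variables, which are affine in \<open>y\<close> with gradient \<open>cgrad\<close>.\<close>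

definition cvar :: "('a::euclidean_space \<Rightarrow> real) \<Rightarrow> 'a set \<Rightarrow> 'a \<Rightarrow> 'a \<Rightarrow> real" where
  "cvar b S n y =
     (if n \<in> S then dual_vec S n \<bullet> (foot b S y - y) else b n - n \<bullet> foot b S y)"

definition cgrad :: "'a::euclidean_space set \<Rightarrow> 'a \<Rightarrow> 'a" where
  "cgrad S n = (if n \<in> S then - dual_vec S n else (\<Sum>m\<in>S. (n \<bullet> dual_vec S m) *\<^sub>R m) - n)"

lemma foot_mem_span:
  assumes "independent S"
  shows "foot b S y - y \<in> span S"
  by (auto simp: foot_def intro!: span_sum span_scale dual_vec[OF assms])

lemma inner_foot:
  assumes "independent S" "n \<in> S"
  shows "n \<bullet> foot b S y = b n"
proof -
  have "(\<Sum>m\<in>S. (b m - m \<bullet> y) * (n \<bullet> dual_vec S m)) = (\<Sum>m\<in>S. if m = n then b n - n \<bullet> y else 0)"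
    using assms by (intro sum.cong refl) (simp add: dual_vec(2)[OF assms(1)] inner_commute[of n])
  then show ?thesis
    using assms independent_imp_finite[OF assms(1)]
    by (simp add: foot_def inner_add_right inner_sum_right)
qed

lemma foot_expansion:
  assumes "independent S"
  shows "foot b S y - y = (\<Sum>n\<in>S. cvar b S n y *\<^sub>R n)"
  using dual_vec_expansion[OF assms foot_mem_span[OF assms, of b y]] by (simp add: cvar_def)

text \<open>Two candidates differ by a vector of \<open>span S\<close> that is orthogonal to
  \<open>S\<close>. Feet and multipliers are computed with this rule below, by exhibiting
  \<open>z\<close> and the coefficients \<open>l\<close>.\<close>

lemma foot_unique:
  assumes S: "independent S"
    and z: "z - y = (\<Sum>n\<in>S. l n *\<^sub>R n)" "\<And>n. n \<in> S \<Longrightarrow> n \<bullet> z = b n"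
  shows "foot b S y = z" "\<And>n. n \<in> S \<Longrightarrow> cvar b S n y = l n"
proof -
  have "z - y \<in> span S"
    unfolding z(1) by (intro span_sum span_scale span_base)
  then have "(z - y) - (foot b S y - y) \<in> span S"
    using foot_mem_span[OF S] span_diff by blast
  then have "z - foot b S y = 0"
    using z(2) inner_foot[OF S]
    by (intro span_orthogonal_eq_0[of _ S]) (auto simp: inner_diff_right)
  then show *: "foot b S y = z"
    by simp
  have "(\<Sum>m\<in>S. l m * (dual_vec S n \<bullet> m)) = l n" if "n \<in> S" for n
    using sum_mult_dual_vec[OF S that] .
  then show "cvar b S n y = l n" if "n \<in> S" for n
    using that by (simp add: cvar_def * z(1) inner_sum_right)
qed

lemma foot_add:
  "foot b S (y + u) = foot b S y + u - (\<Sum>n\<in>S. (n \<bullet> u) *\<^sub>R dual_vec S n)"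
proof -
  have "(\<Sum>n\<in>S. (b n - n \<bullet> (y + u)) *\<^sub>R dual_vec S n) =
        (\<Sum>n\<in>S. (b n - n \<bullet> y) *\<^sub>R dual_vec S n) - (\<Sum>n\<in>S. (n \<bullet> u) *\<^sub>R dual_vec S n)"
    unfolding sum_subtractf[symmetric]
    by (intro sum.cong refl) (simp add: inner_add_right scaleR_diff_left[symmetric])
  then show ?thesis
    by (simp add: foot_def)
qed

lemma cvar_add:
  assumes S: "independent S"
  shows "cvar b S n (y + u) = cvar b S n y + cgrad S n \<bullet> u"
proof (cases "n \<in> S")
  case True
  have "dual_vec S n \<bullet> (\<Sum>m\<in>S. (m \<bullet> u) *\<^sub>R dual_vec S m) =
        (\<Sum>m\<in>S. (dual_vec S m \<bullet> dual_vec S n) *\<^sub>R m) \<bullet> u"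
    by (simp add: inner_sum_right inner_sum_left inner_commute mult.commute)
  also have "\<dots> = dual_vec S n \<bullet> u"
    using dual_vec_expansion[OF S dual_vec(1)[OF S True]] by simp
  finally show ?thesis
    using True by (simp add: cvar_def cgrad_def foot_add inner_diff_right inner_add_right)
next
  case False
  have "n \<bullet> (\<Sum>m\<in>S. (m \<bullet> u) *\<^sub>R dual_vec S m) = (\<Sum>m\<in>S. (n \<bullet> dual_vec S m) *\<^sub>R m) \<bullet> u"
    by (simp add: inner_sum_right inner_sum_left mult.commute)
  with False show ?thesis
    by (simp add: cvar_def cgrad_def foot_add inner_diff_right inner_diff_left inner_add_right)
qed

lemma cvar_minus_scaleR:
  assumes "independent S"
  shows "cvar b S n (y - t *\<^sub>R u) = cvar b S n y - t * (cgrad S n \<bullet> u)"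
  using cvar_add[OF assms, of b n y "- (t *\<^sub>R u)"] by simp

section \<open>Switching one constraint in an active set\<close>

definition toggle :: "'a \<Rightarrow> 'a set \<Rightarrow> 'a set" where
  "toggle i S = (if i \<in> S then S - {i} else insert i S)"

text \<open>A vanishing multiplier drops out of the expansion of \<open>foot b S y - y\<close>, so
  the same point solves the smaller system.\<close>

lemma cvar_remove:
  assumes S: "independent S" and i: "i \<in> S" "cvar b S i y = 0"
  shows "foot b (S - {i}) y = foot b S y" "cvar b (S - {i}) n y = cvar b S n y"
proof -
  have S': "independent (S - {i})"
    using S by (rule independent_mono) auto
  have eq: "foot b S y - y = (\<Sum>n\<in>S - {i}. cvar b S n y *\<^sub>R n)"
    using i independent_imp_finite[OF S] by (simp add: foot_expansion[OF S] sum.remove)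
  note u = foot_unique[OF S' eq, of b]
  show f: "foot b (S - {i}) y = foot b S y"
    using inner_foot[OF S] by (intro u) auto
  show "cvar b (S - {i}) n y = cvar b S n y"
  proof (cases "n \<in> S - {i}")
    case True
    then show ?thesis
      using inner_foot[OF S] by (intro u) auto
  next
    case False
    then show ?thesis
      using i inner_foot[OF S, of n] by (cases "n = i") (auto simp: cvar_def f)
  qed
qed

text \<open>A vanishing slack means that constraint \<open>i\<close> already holds with equality at
  the foot, so \<open>i\<close> can join \<open>S\<close> with multiplier 0.\<close>

lemma cvar_insert:
  assumes S: "independent (insert i S)" and i: "i \<notin> S" "cvar b S i y = 0"
  shows "foot b (insert i S) y = foot b S y" "cvar b (insert i S) n y = cvar b S n y"
proof -
  have S': "independent S"
    using S by (rule independent_mono) auto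
  have eq: "foot b S y - y = (\<Sum>n\<in>insert i S. cvar b S n y *\<^sub>R n)"
    using i independent_imp_finite[OF S'] by (simp add: foot_expansion[OF S'])
  have tight: "n \<bullet> foot b S y = b n" if "n \<in> insert i S" for n
    using that i inner_foot[OF S', of n b y] by (auto simp: cvar_def)
  show f: "foot b (insert i S) y = foot b S y"
    using foot_unique(1)[OF S eq tight] .
  show "cvar b (insert i S) n y = cvar b S n y"
  proof (cases "n \<in> insert i S")
    case True
    then show ?thesis
      using foot_unique(2)[OF S eq tight] by blast
  qed (auto simp: cvar_def f)
qed

text \<open>The product of the two variables is the squared distance between the two feet.\<close>

lemma cvar_insert_pos_iff:
  assumes S: "independent (insert i S)" and i: "i \<notin> S"
  shows "cvar b (insert i S) i y > 0 \<longleftrightarrow> cvar b S i y > 0"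
proof -
  have S': "independent S"
    using S by (rule independent_mono) auto
  have fin: "finite S"
    using S' by (rule independent_imp_finite)
  define z z' l l' where "z = foot b S y" and "z' = foot b (insert i S) y"
    and "l = cvar b S i y" and "l' = cvar b (insert i S) i y"
  have diff: "z' - z = l' *\<^sub>R i + (\<Sum>n\<in>S. (cvar b (insert i S) n y - cvar b S n y) *\<^sub>R n)"
  proof -
    have "z' - z = (z' - y) - (z - y)"
      by simp
    then show ?thesis
      using i fin unfolding z_def z'_def l'_def
      by (simp add: foot_expansion[OF S] foot_expansion[OF S'] sum_subtractf scaleR_diff_left)
  qed
  have perp: "n \<bullet> (z' - z) = 0" if "n \<in> S" for n
    using that inner_foot[OF S] inner_foot[OF S'] by (simp add: z_def z'_def inner_diff_right)
  have iz: "i \<bullet> (z' - z) = l"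
    using i inner_foot[OF S] by (simp add: z_def z'_def l_def cvar_def inner_diff_right)
  have "(z' - z) \<bullet> (z' - z) = l' * l"
    by (subst diff) (simp add: inner_add_left inner_sum_left perp iz)
  then have prod: "l' * l = (norm (z' - z))\<^sup>2"
    by (simp add: dot_square_norm)
  show ?thesis
  proof (cases "z' = z")
    case True
    then have "l = 0"
      using iz by simp
    moreover have "l' = 0"
      using cvar_insert(2)[OF S i, of b y i] \<open>l = 0\<close> by (simp add: l_def l'_def)
    ultimately show ?thesis
      by (simp add: l_def l'_def)
  next
    case False
    then have "l' * l > 0"
      by (simp add: prod)
    then show ?thesis
      by (auto simp: l_def l'_def zero_less_mult_iff)
  qed
qed

lemma cvar_toggle:
  assumes "independent S" "independent (toggle i S)" "cvar b S i y = 0"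
  shows "foot b (toggle i S) y = foot b S y" "cvar b (toggle i S) n y = cvar b S n y"
  using assms cvar_remove[of S i b y] cvar_insert[of i S b y] by (auto simp: toggle_def)

text \<open>This equivalence holds at every \<open>y\<close>, not only where the variable vanishes;
  hence near an event both neighbours are active on the same side.\<close>

lemma cvar_toggle_pos_iff:
  assumes "independent S" "independent (toggle i S)"
  shows "cvar b (toggle i S) i y > 0 \<longleftrightarrow> cvar b S i y > 0"
  using assms cvar_insert_pos_iff[of i S b y] cvar_insert_pos_iff[of i "S - {i}" b y]
  by (auto simp: toggle_def insert_absorb)

section \<open>Parity of the number of active sets along a line\<close>

text \<open>Induction that removes one orbit \<open>{x, f x}\<close> at a time.\<close>

lemma even_card_involution:
  assumes "finite A" "\<And>x. x \<in> A \<Longrightarrow> f x \<in> A" "\<And>x. x \<in> A \<Longrightarrow> f (f x) = x" "\<And>x. x \<in> A \<Longrightarrow> f x \<noteq> x"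
  shows "even (card A)"
  using assms
proof (induction A rule: finite_psubset_induct)
  case (psubset A)
  show ?case
  proof (cases "A = {}")
    case False
    then obtain x where x: "x \<in> A"
      by blast
    have "even (card (A - {x, f x}))"
    proof (rule psubset.IH)
      show "f y \<in> A - {x, f x}" if "y \<in> A - {x, f x}" for y
        using that psubset.prems x by (metis Diff_iff insertE insertI1 insertI2 singletonD)
    qed (use x psubset.prems in auto)
    moreover have "card A = card (A - {x, f x}) + 2"
    proof -
      have "{x, f x} \<subseteq> A" "card {x, f x} = 2"
        using x psubset.prems(1,3)[OF x] by auto
      then show ?thesis
        using psubset.hyps by (metis card_Diff_subset card_mono finite_subset le_add_diff_inverse2)
    qed
    ultimately show ?thesis
      by simp
  qed simp
qed

text \<open>A hyperplane has empty interior, so removing one from a nonempty open set leaves a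
  nonempty open set.\<close>

lemma exists_avoiding_hyperplanes:
  fixes U :: "'a::euclidean_space set"
  assumes "finite W" "open U" "U \<noteq> {}"
  shows "\<exists>x\<in>U. \<forall>w\<in>W. w \<noteq> 0 \<longrightarrow> w \<bullet> x \<noteq> 0"
  using assms
proof (induction W arbitrary: U rule: finite_induct)
  case (insert w W)
  show ?case
  proof (cases "w = 0")
    case True
    then show ?thesis
      using insert.IH[OF insert.prems] by auto
  next
    case False
    have "U - {x. w \<bullet> x = 0} \<noteq> {}"
    proof
      assume "U - {x. w \<bullet> x = 0} = {}"
      then have "U \<subseteq> interior {x. w \<bullet> x = 0}"
        using insert.prems(1) by (intro interior_maximal) auto
      then show False
        using interior_hyperplane[OF False, of 0] insert.prems(2) by auto
    qed
    moreover have "open (U - {x. w \<bullet> x = 0})"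
      using insert.prems(1) closed_hyperplane by (rule open_Diff)
    ultimately show ?thesis
      using insert.IH[of "U - {x. w \<bullet> x = 0}"] by auto
  qed
qed auto

text \<open>If \<open>i \<in> S\<close>, moving \<open>y\<close> along \<open>i\<close> keeps the
  foot and changes only the multiplier of \<open>i\<close>. Otherwise move along the dual vector of
  \<open>i\<close> in the enlarged set: it is orthogonal to \<open>S\<close>, so the foot moves
  along with \<open>y\<close>, the multipliers stay fixed, and the slack of \<open>i\<close> changes
  while that of \<open>j\<close> does not.\<close>

lemma cgrad_separating:
  fixes S :: "'a::euclidean_space set"
  assumes ind: "independent (insert i (insert j S))" and ij: "i \<noteq> j"
  shows "\<exists>u. cgrad S i \<bullet> u = -1 \<and> cgrad S j \<bullet> u = 0"
proof -
  have S: "independent S"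
    using ind by (rule independent_mono) auto
  show ?thesis
  proof (cases "i \<in> S")
    case True
    \<comment> \<open>\<open>cgrad\<close> involves neither \<open>b\<close> nor the base point, so
      the computation may use right-hand side 0 and base point 0.\<close>
    define b :: "'a \<Rightarrow> real" where "b = (\<lambda>_. 0)"
    have eq: "foot b S 0 - (0 + i) = (\<Sum>n\<in>S. (cvar b S n 0 - (if n = i then 1 else 0)) *\<^sub>R n)"
    proof -
      have "(\<Sum>n\<in>S. (if n = i then 1 else 0) *\<^sub>R n) = (\<Sum>n\<in>S. if n = i then n else 0)"
        by (intro sum.cong) auto
      also have "\<dots> = i"
        using True independent_imp_finite[OF S] by simp
      finally show ?thesis
        using foot_expansion[OF S, of b 0] by (simp add: scaleR_diff_left sum_subtractf)
    qed
    note u = foot_unique[OF S eq inner_foot[OF S]]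
    have *: "cvar b S n (0 + i) = cvar b S n 0 - (if n = i then 1 else 0)" for n
    proof (cases "n \<in> S")
      case True
      then show ?thesis
        using u(2) by simp
    next
      case False
      then show ?thesis
        using \<open>i \<in> S\<close> u(1) by (auto simp: cvar_def)
    qed
    show ?thesis
      using *[of i] *[of j] ij unfolding cvar_add[OF S] by (intro exI[of _ i]) auto
  next
    case False
    define u where "u = dual_vec (insert i (insert j S)) i"
    have du: "u \<bullet> y = (if y = i then 1 else 0)" if "y \<in> insert i (insert j S)" for y
      unfolding u_def using that by (intro dual_vec(2)[OF ind]) auto
    have perp: "m \<bullet> u = 0" if "m \<in> S" for m
      using du[of m] that False by (auto simp: inner_commute)
    have out: "cgrad S n \<bullet> u = - (n \<bullet> u)" if "n \<notin> S" for n
      using that by (simp add: cgrad_def inner_diff_left inner_sum_left perp)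
    have "cgrad S j \<bullet> u = 0"
    proof (cases "j \<in> S")
      case True
      have "orthogonal u (dual_vec S j)"
      proof (rule orthogonal_to_span[OF dual_vec(1)[OF S True]])
        show "orthogonal u m" if "m \<in> S" for m
          using perp[OF that] by (metis inner_commute orthogonal_def)
      qed
      then have "dual_vec S j \<bullet> u = 0"
        by (metis inner_commute orthogonal_def)
      then show ?thesis
        using True by (simp add: cgrad_def)
    next
      case j: False
      then show ?thesis
        using out[OF j] du[of j] ij by (simp add: inner_commute[of j])
    qed
    moreover have "cgrad S i \<bullet> u = -1"
      using out[OF False] du[of i] by (simp add: inner_commute[of i])
    ultimately show ?thesis
      by blast
  qed
qed

text \<open>Constraints are identified with their normals, so the right-hand side \<open>b\<close>
  is a function of the normal. Simplicity is encoded as independence of the normals that are tight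
  at any feasible point; this keeps active sets independent when a constraint is switched at an
  event.\<close>

locale simple_halfspaces =
  fixes N :: "'a::euclidean_space set" and b :: "'a \<Rightarrow> real"
  assumes finite_N: "finite N"
    and independent_tight: "\<And>z. (\<And>n. n \<in> N \<Longrightarrow> n \<bullet> z \<le> b n) \<Longrightarrow> independent {n \<in> N. n \<bullet> z = b n}"
begin

definition poly :: "'a set" where
  "poly = {z. \<forall>n\<in>N. n \<bullet> z \<le> b n}"

definition tight :: "'a \<Rightarrow> 'a set" where
  "tight z = {n \<in> N. n \<bullet> z = b n}"

text \<open>\<open>weak\<close> and \<open>strict\<close> describe closed and open active regions:
  the sign condition covers the multipliers of \<open>S\<close> and the slacks of the remaining
  constraints at once. The elements of \<open>strict y\<close> are the active sets that are
  counted.\<close>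

definition weak :: "'a \<Rightarrow> 'a set set" where
  "weak y = {S. S \<subseteq> N \<and> independent S \<and> (\<forall>n\<in>N. 0 \<le> cvar b S n y)}"

definition strict :: "'a \<Rightarrow> 'a set set" where
  "strict y = {S. S \<subseteq> N \<and> independent S \<and> (\<forall>n\<in>N. 0 < cvar b S n y)}"

lemma strict_subset_weak: "strict y \<subseteq> weak y"
  by (auto simp: strict_def weak_def less_imp_le)

lemma finite_weak: "finite (weak y)" and finite_strict: "finite (strict y)"
  by (rule finite_subset[of _ "Pow N"]; use finite_N in \<open>auto simp: weak_def strict_def\<close>)+

lemma foot_mem_poly:
  assumes "S \<in> weak y"
  shows "foot b S y \<in> poly"
proof -
  have "n \<bullet> foot b S y \<le> b n" if "n \<in> N" for n
    using assms that inner_foot[of S n b y]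
    by (cases "n \<in> S") (auto simp: weak_def cvar_def)
  then show ?thesis
    by (simp add: poly_def)
qed

lemma subset_tight_foot:
  assumes "S \<in> weak y"
  shows "S \<subseteq> tight (foot b S y)"
  using assms inner_foot[of S _ b y] by (auto simp: weak_def tight_def)

lemma tight_foot_eq:
  assumes "S \<in> strict y"
  shows "tight (foot b S y) = S"
proof
  show "S \<subseteq> tight (foot b S y)"
    using assms strict_subset_weak by (intro subset_tight_foot) auto
  show "tight (foot b S y) \<subseteq> S"
    using assms by (fastforce simp: tight_def strict_def cvar_def split: if_splits)
qed

text \<open>Both \<open>S\<close> and \<open>Z\<close> consist of constraints tight at the foot,
  which is a point of \<open>poly\<close>, so \<open>independent_tight\<close> applies.\<close>

lemma independent_insert_zeros:
  assumes S: "S \<in> weak y" and Z: "Z \<subseteq> N" "\<And>i. i \<in> Z \<Longrightarrow> cvar b S i y = 0"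
  shows "independent (S \<union> Z)"
proof -
  have "Z \<subseteq> tight (foot b S y)"
  proof
    fix i assume i: "i \<in> Z"
    show "i \<in> tight (foot b S y)"
    proof (cases "i \<in> S")
      case False
      then show ?thesis
        using Z(1) Z(2)[OF i] i by (auto simp: tight_def cvar_def)
    qed (use subset_tight_foot[OF S] in auto)
  qed
  then have "S \<union> Z \<subseteq> tight (foot b S y)"
    using subset_tight_foot[OF S] by blast
  moreover have "independent (tight (foot b S y))"
    unfolding tight_def using foot_mem_poly[OF S] by (intro independent_tight) (auto simp: poly_def)
  ultimately show ?thesis
    using independent_mono by blast
qed

lemma toggle_mem_weak:
  assumes S: "S \<in> weak y" and i: "i \<in> N" "cvar b S i y = 0"
  shows "independent (toggle i S)" "toggle i S \<in> weak y"
    "foot b (toggle i S) y = foot b S y" "cvar b (toggle i S) n y = cvar b S n y"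
proof -
  have S': "independent S"
    using S by (simp add: weak_def)
  have "independent (S \<union> {i})"
    using i by (intro independent_insert_zeros[OF S]) auto
  then show ind: "independent (toggle i S)"
    by (rule independent_mono) (auto simp: toggle_def)
  note t = cvar_toggle[OF S' ind i(2)]
  show "foot b (toggle i S) y = foot b S y" "cvar b (toggle i S) n y = cvar b S n y"
    by (rule t)+
  show "toggle i S \<in> weak y"
    using S i ind by (auto simp: weak_def t) (auto simp: toggle_def split: if_splits)
qed

text \<open>The second condition says that the line through \<open>V\<close> in direction \<open>X\<close> avoids the zero set of
  two complementary variables with independent gradients.\<close>

definition generic_dir :: "'a \<Rightarrow> 'a \<Rightarrow> bool" where
  "generic_dir V X \<longleftrightarrow> (\<forall>S\<in>Pow N. \<forall>i\<in>N. \<forall>j\<in>N.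
     (cgrad S i \<noteq> 0 \<longrightarrow> cgrad S i \<bullet> X \<noteq> 0) \<and>
     (cvar b S j V *\<^sub>R cgrad S i - cvar b S i V *\<^sub>R cgrad S j \<noteq> 0 \<longrightarrow>
       (cvar b S j V *\<^sub>R cgrad S i - cvar b S i V *\<^sub>R cgrad S j) \<bullet> X \<noteq> 0))"

lemma exists_generic_dir:
  assumes "open U" "U \<noteq> {}"
  shows "\<exists>X\<in>U. generic_dir V X"
proof -
  define W where "W =
    (\<lambda>(S, i). cgrad S i) ` (Pow N \<times> N) \<union>
    (\<lambda>(S, i, j). cvar b S j V *\<^sub>R cgrad S i - cvar b S i V *\<^sub>R cgrad S j) ` (Pow N \<times> N \<times> N)"
  have "finite W"
    unfolding W_def using finite_N by auto
  from exists_avoiding_hyperplanes[OF this assms] obtain X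
    where X: "X \<in> U" "\<forall>w\<in>W. w \<noteq> 0 \<longrightarrow> w \<bullet> X \<noteq> 0"
    by blast
  have "cgrad S i \<in> W"
    "cvar b S j V *\<^sub>R cgrad S i - cvar b S i V *\<^sub>R cgrad S j \<in> W"
    if "S \<in> Pow N" "i \<in> N" "j \<in> N" for S i j
    using that by (auto simp: W_def intro: rev_image_eqI[of "(S, i)"] rev_image_eqI[of "(S, i, j)"])
  then have "generic_dir V X"
    unfolding generic_dir_def using X(2) by blast
  with X(1) show ?thesis
    by blast
qed

section \<open>Events along a generic line\<close>

context
  fixes V X :: 'a
  assumes generic: "generic_dir V X"
begin

text \<open>The gradient cannot be 0: for a multiplier because
  \<open>dual_vec S i \<bullet> i = 1\<close>, for a slack because \<open>i\<close> would then lie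
  in \<open>span S\<close>. Genericity of \<open>X\<close> turns a nonzero gradient into a nonzero
  slope.\<close>

lemma cvar_line_slope:
  assumes S: "S \<in> weak (V - t *\<^sub>R X)" and i: "i \<in> N" "cvar b S i (V - t *\<^sub>R X) = 0"
  shows "cgrad S i \<bullet> X \<noteq> 0"
proof -
  have "cgrad S i \<noteq> 0"
  proof
    assume 0: "cgrad S i = 0"
    have ind: "independent (S \<union> {i})"
      using i by (intro independent_insert_zeros[OF S]) auto
    show False
    proof (cases "i \<in> S")
      case True
      then have "dual_vec S i = 0" "dual_vec S i \<bullet> i = 1"
        using 0 S dual_vec(2)[of S i i] by (auto simp: cgrad_def weak_def)
      then show False
        by simp
    next
      case False
      then have "i = (\<Sum>m\<in>S. (i \<bullet> dual_vec S m) *\<^sub>R m)"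
        using 0 by (simp add: cgrad_def)
      also have "\<dots> \<in> span S"
        by (intro span_sum span_scale span_base)
      finally show False
        using ind False by (simp add: independent_insert)
    qed
  qed
  then show ?thesis
    using generic S i unfolding generic_dir_def weak_def by auto
qed

text \<open>Two simultaneous zeros make the combination \<open>w\<close> of the gradients orthogonal
  to \<open>X\<close>, hence 0 by genericity. A direction that changes only variable
  \<open>i\<close> then shows \<open>cvar b S j V = 0\<close>, contradicting the nonzero slope of
  \<open>j\<close>. Positivity of \<open>t\<close> matters: at \<open>V\<close> itself several
  variables may vanish together.\<close>

lemma cvar_line_zero_unique:
  assumes S: "S \<in> weak (V - t *\<^sub>R X)" and t: "t > 0"
    and i: "i \<in> N" "cvar b S i (V - t *\<^sub>R X) = 0" and j: "j \<in> N" "cvar b S j (V - t *\<^sub>R X) = 0"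
  shows "i = j"
proof (rule ccontr)
  assume ij: "i \<noteq> j"
  have S': "independent S" "S \<in> Pow N"
    using S by (auto simp: weak_def)
  define w where "w = cvar b S j V *\<^sub>R cgrad S i - cvar b S i V *\<^sub>R cgrad S j"
  have vi: "cvar b S i V = t * (cgrad S i \<bullet> X)" and vj: "cvar b S j V = t * (cgrad S j \<bullet> X)"
    using i j by (simp_all add: cvar_minus_scaleR[OF S'(1)])
  have "w \<bullet> X = 0"
    by (simp add: w_def vi vj inner_diff_left)
  then have w0: "w = 0"
    using generic S'(2) i(1) j(1) unfolding generic_dir_def w_def by blast
  have "independent (S \<union> {i, j})"
    using i j by (intro independent_insert_zeros[OF S]) auto
  then obtain u where "cgrad S i \<bullet> u = -1" "cgrad S j \<bullet> u = 0"
    using cgrad_separating[of i j S] ij by auto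
  then have "w \<bullet> u = - cvar b S j V"
    by (simp add: w_def inner_diff_left)
  then have "cvar b S j V = 0"
    using w0 by simp
  then show False
    using vj t cvar_line_slope[OF S j] by simp
qed

lemma eventually_cvar_sign:
  "\<forall>\<^sub>F s in at t. \<forall>S\<in>Pow N. \<forall>n\<in>N. independent S \<longrightarrow>
     (0 < cvar b S n (V - t *\<^sub>R X) \<longrightarrow> 0 < cvar b S n (V - s *\<^sub>R X)) \<and>
     (cvar b S n (V - t *\<^sub>R X) < 0 \<longrightarrow> cvar b S n (V - s *\<^sub>R X) < 0)"
proof -
  have "\<forall>\<^sub>F s in at t. independent S \<longrightarrow>
     (0 < cvar b S n (V - t *\<^sub>R X) \<longrightarrow> 0 < cvar b S n (V - s *\<^sub>R X)) \<and>
     (cvar b S n (V - t *\<^sub>R X) < 0 \<longrightarrow> cvar b S n (V - s *\<^sub>R X) < 0)" if "S \<in> Pow N" "n \<in> N" for S n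
  proof (cases "independent S")
    case True
    have lim: "((\<lambda>s. cvar b S n (V - s *\<^sub>R X)) \<longlongrightarrow> cvar b S n (V - t *\<^sub>R X)) (at t)"
      unfolding cvar_minus_scaleR[OF True] by (intro tendsto_intros)
    show ?thesis
      using order_tendstoD[OF lim]
      by (cases "0 < cvar b S n (V - t *\<^sub>R X)"; cases "cvar b S n (V - t *\<^sub>R X) < 0") (auto elim: eventually_mono)
  qed simp
  then show ?thesis
    using finite_N by (simp add: eventually_ball_finite_distrib)
qed

text \<open>These sets are on the boundary of being active at \<open>t\<close> and active on the
  side of \<open>s\<close>. As \<open>s\<close> may lie before or after \<open>t\<close>, both
  disappearing and appearing sets are covered.\<close>

definition entering :: "real \<Rightarrow> real \<Rightarrow> 'a set set" where
  "entering t s =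
     {S \<in> weak (V - t *\<^sub>R X). \<exists>i\<in>N. cvar b S i (V - t *\<^sub>R X) = 0 \<and> 0 < cvar b S i (V - s *\<^sub>R X)}"

text \<open>Close to \<open>t\<close> the nonzero variables keep their signs, and a weakly active
  set has at most one zero variable at \<open>t\<close>, so the sign of that variable at
  \<open>s\<close> decides.\<close>

lemma eventually_strict_eq:
  assumes t: "t > 0"
  shows "\<forall>\<^sub>F s in at t. strict (V - s *\<^sub>R X) = strict (V - t *\<^sub>R X) \<union> entering t s"
  using eventually_cvar_sign[of t]
proof (rule eventually_mono)
  fix s
  assume *: "\<forall>S\<in>Pow N. \<forall>n\<in>N. independent S \<longrightarrow>
     (0 < cvar b S n (V - t *\<^sub>R X) \<longrightarrow> 0 < cvar b S n (V - s *\<^sub>R X)) \<and>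
     (cvar b S n (V - t *\<^sub>R X) < 0 \<longrightarrow> cvar b S n (V - s *\<^sub>R X) < 0)"
  have 1: "S \<in> strict (V - s *\<^sub>R X)" if "S \<in> strict (V - t *\<^sub>R X)" for S
    using that * by (auto simp: strict_def)
  have 2: "S \<in> strict (V - s *\<^sub>R X)" if SE: "S \<in> entering t s" for S
  proof -
    obtain i where S: "S \<in> weak (V - t *\<^sub>R X)" and i: "i \<in> N" "cvar b S i (V - t *\<^sub>R X) = 0" "0 < cvar b S i (V - s *\<^sub>R X)"
      using SE unfolding entering_def by blast
    have "0 < cvar b S n (V - s *\<^sub>R X)" if "n \<in> N" for n
    proof (cases "n = i")
      case False
      then have "0 < cvar b S n (V - t *\<^sub>R X)"
        using cvar_line_zero_unique[OF S t i(1,2) that] S that by (force simp: weak_def)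
      then show ?thesis
        using * S that by (auto simp: weak_def)
    qed (use i in simp)
    with S show ?thesis
      by (auto simp: strict_def weak_def)
  qed
  have 3: "S \<in> strict (V - t *\<^sub>R X) \<union> entering t s" if S: "S \<in> strict (V - s *\<^sub>R X)" for S
  proof -
    have "0 \<le> cvar b S n (V - t *\<^sub>R X)" if n: "n \<in> N" for n
    proof (rule ccontr)
      assume "\<not> 0 \<le> cvar b S n (V - t *\<^sub>R X)"
      then have "cvar b S n (V - s *\<^sub>R X) < 0"
        using * S n by (auto simp: strict_def)
      moreover have "0 < cvar b S n (V - s *\<^sub>R X)"
        using S n by (auto simp: strict_def)
      ultimately show False
        by simp
    qed
    with S have w: "S \<in> weak (V - t *\<^sub>R X)"
      by (auto simp: strict_def weak_def)
    show ?thesis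
    proof (cases "S \<in> strict (V - t *\<^sub>R X)")
      case False
      then obtain i where "i \<in> N" "cvar b S i (V - t *\<^sub>R X) = 0"
        using w by (force simp: strict_def weak_def)
      then show ?thesis
        using w S by (auto simp: entering_def strict_def)
    qed simp
  qed
  show "strict (V - s *\<^sub>R X) = strict (V - t *\<^sub>R X) \<union> entering t s"
    using 1 2 3 by blast
qed

lemma toggle_mem_entering:
  assumes S: "S \<in> weak (V - t *\<^sub>R X)" and i: "i \<in> N" "cvar b S i (V - t *\<^sub>R X) = 0" "0 < cvar b S i (V - s *\<^sub>R X)"
  shows "toggle i S \<in> entering t s"
proof -
  note tog = toggle_mem_weak[OF S i(1,2)]
  have "0 < cvar b (toggle i S) i (V - s *\<^sub>R X)"
    using S i tog(1) by (subst cvar_toggle_pos_iff) (auto simp: weak_def)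
  then show ?thesis
    using tog i unfolding entering_def by auto
qed

text \<open>Toggling the unique vanishing variable pairs these sets. It is an involution because the
  neighbour has the same vanishing variable.\<close>

lemma even_card_entering:
  assumes t: "t > 0"
  shows "even (card (entering t s))"
proof -
  define i where "i S = (SOME i. i \<in> N \<and> cvar b S i (V - t *\<^sub>R X) = 0 \<and> 0 < cvar b S i (V - s *\<^sub>R X))" for S
  have i: "i S \<in> N" "cvar b S (i S) (V - t *\<^sub>R X) = 0" "0 < cvar b S (i S) (V - s *\<^sub>R X)" and w: "S \<in> weak (V - t *\<^sub>R X)"
    if "S \<in> entering t s" for S
  proof -
    have "\<exists>i. i \<in> N \<and> cvar b S i (V - t *\<^sub>R X) = 0 \<and> 0 < cvar b S i (V - s *\<^sub>R X)"
      using that by (auto simp: entering_def)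
    from someI_ex[OF this]
    show "i S \<in> N" "cvar b S (i S) (V - t *\<^sub>R X) = 0" "0 < cvar b S (i S) (V - s *\<^sub>R X)"
      by (simp_all add: i_def)
    show "S \<in> weak (V - t *\<^sub>R X)"
      using that by (simp add: entering_def)
  qed
  have tog: "toggle (i S) S \<in> entering t s" if "S \<in> entering t s" for S
    using i[OF that] w[OF that] by (intro toggle_mem_entering)
  have same: "i (toggle (i S) S) = i S" if "S \<in> entering t s" for S
    using toggle_mem_weak(4)[OF w[OF that] i(1,2)[OF that]] i[OF that]
    by (intro cvar_line_zero_unique[OF w[OF tog[OF that]] t i(1,2)[OF tog[OF that]]]) auto
  show ?thesis
  proof (rule even_card_involution[where f = "\<lambda>S. toggle (i S) S"])
    show "finite (entering t s)"
      by (rule finite_subset[OF _ finite_weak[of "(V - t *\<^sub>R X)"]]) (auto simp: entering_def)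
    show "toggle (i (toggle (i S) S)) (toggle (i S) S) = S" if "S \<in> entering t s" for S
      unfolding same[OF that] by (auto simp: toggle_def)
    show "toggle (i S) S \<in> entering t s" if "S \<in> entering t s" for S
      using that by (rule tog)
    show "toggle (i S) S \<noteq> S" for S
      by (auto simp: toggle_def)
  qed
qed

text \<open>By the pairing, the parity is locally constant on the connected set of positive
  parameters.\<close>

lemma odd_card_strict_const:
  assumes "t > 0" "t' > 0"
  shows "odd (card (strict (V - t *\<^sub>R X))) \<longleftrightarrow> odd (card (strict (V - t' *\<^sub>R X)))"
proof -
  define f where "f t = odd (card (strict (V - t *\<^sub>R X)))" for t
  have const: "\<forall>\<^sub>F s in at t within {0<..}. f t = f s" if t: "t \<in> {0<..}" for t
  proof -
    have "\<forall>\<^sub>F s in at t. f t = f s"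
    proof (rule eventually_mono)
      show "\<forall>\<^sub>F s in at t. strict (V - s *\<^sub>R X) = strict (V - t *\<^sub>R X) \<union> entering t s"
        using t by (intro eventually_strict_eq) simp
      fix s
      assume eq: "strict (V - s *\<^sub>R X) = strict (V - t *\<^sub>R X) \<union> entering t s"
      have "finite (entering t s)"
        by (rule finite_subset[OF _ finite_weak[of "(V - t *\<^sub>R X)"]]) (auto simp: entering_def)
      moreover have "strict (V - t *\<^sub>R X) \<inter> entering t s = {}"
        by (auto simp: entering_def strict_def)
      ultimately have "card (strict (V - s *\<^sub>R X)) = card (strict (V - t *\<^sub>R X)) + card (entering t s)"
        by (simp add: eq card_Un_disjoint finite_strict)
      then show "f t = f s"
        using even_card_entering[of t s] t by (simp add: f_def)
    qed
    then show ?thesis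
      unfolding eventually_at by blast
  qed
  have "connected {0::real<..}" "t \<in> {0<..}" "t' \<in> {0<..}"
    using assms by auto
  from connected_local_const[OF this] const have "f t = f t'"
    by blast
  then show ?thesis
    by (simp add: f_def)
qed

text \<open>Far out on the line, \<open>V\<close> is the only critical point.\<close>

lemma odd_card_strict:
  assumes bdd: "bounded poly"
    and V: "\<And>t. t > 0 \<Longrightarrow> tight V \<in> strict (V - t *\<^sub>R X)" and c: "c > 0"
    "\<And>p. p \<in> poly \<Longrightarrow> c * norm (V - p) \<le> X \<bullet> (V - p)"
    and Vp: "V \<in> poly" and t: "t > 0"
  shows "odd (card (strict (V - t *\<^sub>R X)))"
proof -
  obtain D where D: "\<And>p. p \<in> poly \<Longrightarrow> norm (V - p) \<le> D"
    using bdd unfolding bounded_any_center[of _ V] dist_norm by blast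
  have D0: "D \<ge> 0"
    using D[OF Vp] by simp
  define T where "T = D / c + 1"
  have T: "T > 0" "c * T > D"
    using c(1) D0 by (simp_all add: T_def distrib_left add_nonneg_pos)
  have "strict (V - T *\<^sub>R X) = {tight V}"
  proof
    show "{tight V} \<subseteq> strict (V - T *\<^sub>R X)"
      using V[OF T(1)] by simp
    show "strict (V - T *\<^sub>R X) \<subseteq> {tight V}"
    proof
      fix S assume S: "S \<in> strict (V - T *\<^sub>R X)"
      define z where "z = foot b S (V - T *\<^sub>R X)"
      have S': "independent S" "S \<subseteq> N"
        using S by (auto simp: strict_def)
      have z: "z \<in> poly"
        unfolding z_def using S strict_subset_weak by (intro foot_mem_poly) auto
      \<comment> \<open>The variational inequality of the foot \<open>z\<close>, tested at the
        feasible point \<open>V\<close>. With the lower bound on \<open>X \<bullet> (V - z)\<close>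
        it yields \<open>c * T * norm (V - z) \<le> norm (V - z) * norm (V - z)\<close>, which is
        impossible for \<open>z \<noteq> V\<close> since \<open>D < c * T\<close>.\<close>
      have "(V - z) \<bullet> (z - (V - T *\<^sub>R X)) = (\<Sum>n\<in>S. cvar b S n (V - T *\<^sub>R X) * ((V - z) \<bullet> n))"
        unfolding z_def foot_expansion[OF S'(1)] by (simp add: inner_sum_right)
      also have "\<dots> \<le> 0"
      proof (intro sum_nonpos mult_nonneg_nonpos)
        fix n assume n: "n \<in> S"
        show "0 \<le> cvar b S n (V - T *\<^sub>R X)"
          using S n by (force simp: strict_def)
        have "n \<bullet> V \<le> b n" "n \<bullet> z = b n"
          using Vp n S' inner_foot[OF S'(1) n] by (auto simp: poly_def z_def)
        then show "(V - z) \<bullet> n \<le> 0"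
          by (simp add: inner_commute[of _ n] inner_diff_right)
      qed
      finally have "T * (X \<bullet> (V - z)) \<le> (V - z) \<bullet> (V - z)"
        by (simp add: inner_diff_left inner_diff_right inner_add_right inner_add_left
            inner_commute[of X] algebra_simps)
      moreover have "T * (c * norm (V - z)) \<le> T * (X \<bullet> (V - z))"
        using c(2)[OF z] T(1) by simp
      ultimately have "(c * T) * norm (V - z) \<le> norm (V - z) * norm (V - z)"
        by (simp add: dot_square_norm power2_eq_square mult_ac)
      then have "V = z"
        using D[OF z] T(2) by (simp add: mult_le_cancel_right)
      then show "S \<in> {tight V}"
        using tight_foot_eq[OF S] by (simp add: z_def)
    qed
  qed
  then show ?thesis
    using odd_card_strict_const[OF t T(1)] by simp
qed

end

end

section \<open>The first event on a line from a vertex\<close>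

context simple_halfspaces
begin

lemma foot_eq_tight_point:
  assumes "independent S" "S \<subseteq> tight V"
  shows "foot b S V = V"
  using assms by (intro foot_unique(1)[where l = "\<lambda>_. 0"]) (auto simp: tight_def)

text \<open>These variables vanish at \<open>V\<close> and are affine, hence homogeneous along the
  line: their sign at parameter 1 is their sign at every positive parameter.\<close>

lemma cvar_line_tight:
  assumes S: "independent S" "S \<subseteq> tight V" and n: "n \<in> tight V"
  shows "cvar b S n (V - t *\<^sub>R X) = t * cvar b S n (V - X)"
proof -
  have "cvar b S n V = 0"
    using n by (simp add: cvar_def foot_eq_tight_point[OF S] tight_def)
  then show ?thesis
    using cvar_minus_scaleR[OF S(1), of b n V t X] cvar_minus_scaleR[OF S(1), of b n V 1 X] by simp
qed

lemma foot_empty [simp]: "foot b {} y = y"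
  by (simp add: foot_def)

text \<open>Moving away from \<open>V\<close> in direction \<open>- X\<close>, the first of the initially active sets to become
  inactive does so together with a neighbour, which is a new active set.\<close>

lemma exists_many_strict:
  assumes bdd: "bounded poly" and V: "V \<in> poly" and A: "independent (tight V)" "span (tight V) = UNIV" "tight V \<noteq> {}"
    and generic: "generic_dir V X"
    and pos: "\<And>S n. S \<subseteq> tight V \<Longrightarrow> n \<in> tight V \<Longrightarrow> 0 < cvar b S n (V - X)"
    and c: "c > 0" "\<And>p. p \<in> poly \<Longrightarrow> c * norm (V - p) \<le> X \<bullet> (V - p)"
    and U: "U \<in> poly" "U \<noteq> V" "\<And>p. p \<in> poly \<Longrightarrow> dist V p \<le> dist V U"
    and C: "tight U \<in> strict V" "span (tight U) = UNIV" "\<not> (\<exists>n. tight U \<subseteq> {n})"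
  shows "\<exists>y. {} \<in> strict y \<and> 2 ^ card (tight V) + 3 \<le> card (strict y)"
proof -
  define A where "A = tight V"
  define C where "C = tight U"
  define y where "y t = V - t *\<^sub>R X" for t
  \<comment> \<open>The initially active sets: one for each face through \<open>V\<close>, with
    \<open>{}\<close> standing for the whole polytope, and one for the farthest vertex
    \<open>U\<close>.\<close>
  define B where "B = insert C (Pow A)"
  have indA: "independent S" if "S \<subseteq> A" for S
    using A(1) that independent_mono unfolding A_def by blast
  have AN: "A \<subseteq> N" and CN: "C \<subseteq> N"
    by (auto simp: A_def C_def tight_def)
  have finA: "finite A"
    using AN finite_N finite_subset by blast
  have indC: "independent C"
    using C(1) by (simp add: strict_def C_def)
  \<comment> \<open>The constraints of \<open>C\<close> determine the point \<open>U\<close>, so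
    this foot does not depend on the base point.\<close>
  have footC: "foot b C z = U" for z
  proof -
    have "foot b C z - U = 0"
      using inner_foot[OF indC] C(2)
      by (intro span_orthogonal_eq_0[of _ C]) (auto simp: C_def tight_def inner_diff_right)
    then show ?thesis
      by simp
  qed
  have CA: "\<not> C \<subseteq> A"
    using footC[of V] foot_eq_tight_point[OF indC] U(2) by (auto simp: A_def)
  have cardB: "card B = 2 ^ card A + 1"
    using CA finA by (simp add: B_def card_Pow)
  have B_ind: "independent S" "S \<subseteq> N" if "S \<in> B" for S
    using that indC CN indA AN by (auto simp: B_def)
  have lineA: "cvar b S n (y t) = t * cvar b S n (V - X)" if "S \<subseteq> A" "n \<in> A" for S n t
    using cvar_line_tight[OF indA[OF that(1)]] that by (simp add: y_def A_def)
  have lim: "((\<lambda>s. cvar b S n (y s)) \<longlongrightarrow> cvar b S n (y t)) (at t within T)" if "S \<in> B" for S n t T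
    unfolding y_def cvar_minus_scaleR[OF B_ind(1)[OF that]] by (intro tendsto_intros)

  have "\<forall>\<^sub>F t in at_right 0. \<forall>S\<in>B. \<forall>n\<in>N. 0 < cvar b S n (y t)"
  proof -
    have "\<forall>\<^sub>F t in at_right 0. 0 < cvar b S n (y t)" if S: "S \<in> B" and n: "n \<in> N" for S n
    \<comment> \<open>Variables indexed by \<open>A\<close>, for subsets of \<open>A\<close>, are
      positive multiples of their values at \<open>V - X\<close>. All other variables are already
      positive at \<open>V\<close> and stay so by continuity.\<close>
    proof (cases "S \<subseteq> A \<and> n \<in> A")
      case True
      then have "0 < cvar b S n (y t)" if "t > 0" for t
        using pos lineA[of S n t] that by (simp add: A_def)
      then show ?thesis
        using eventually_at_right_less[of 0] by (auto elim: eventually_mono)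
    next
      case False
      have "0 < cvar b S n V"
      proof (cases "S \<subseteq> A")
        case True
        then have "foot b S V = V"
          using indA by (intro foot_eq_tight_point) (auto simp: A_def)
        moreover have "n \<bullet> V \<le> b n" "n \<bullet> V \<noteq> b n"
          using V n False True by (auto simp: poly_def A_def tight_def)
        ultimately show ?thesis
          using False True by (auto simp: cvar_def)
      next
        case False
        then show ?thesis
          using S C(1) n by (auto simp: B_def C_def strict_def)
      qed
      then have "0 < cvar b S n (y 0)"
        by (simp add: y_def)
      from order_tendstoD(1)[OF lim[OF S] this] show ?thesis .
    qed
    moreover have "finite B"
      using finA by (simp add: B_def)
    ultimately show ?thesis
      using finite_N by (simp add: eventually_ball_finite_distrib)
  qed
  then have "\<forall>\<^sub>F t in at_right 0. B \<subseteq> strict (y t)"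
    by (rule eventually_mono) (use B_ind in \<open>unfold strict_def, blast\<close>)
  then obtain d0 where d0: "d0 > 0" "\<And>t. 0 < t \<Longrightarrow> t < d0 \<Longrightarrow> B \<subseteq> strict (y t)"
    unfolding eventually_at_right_field by auto

  \<comment> \<open>The parameters at which some member of \<open>B\<close> is inactive. There are
    such parameters because \<open>{}\<close> is active only inside the bounded set
    \<open>poly\<close>, which the line leaves. The infimum of \<open>Q\<close> is the first
    event.\<close>
  define Q where "Q = {t. t > 0 \<and> \<not> B \<subseteq> strict (y t)}"
  have "Q \<noteq> {}"
  proof
    assume "Q = {}"
    then have "B \<subseteq> strict (y t)" if "t > 0" for t
      using that by (auto simp: Q_def)
    then have yP: "y t \<in> poly" if "t > 0" for t
      using foot_mem_poly[of "{}" "y t"] strict_subset_weak that by (fastforce simp: B_def)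
    obtain D where D: "\<And>p. p \<in> poly \<Longrightarrow> norm (V - p) \<le> D"
      using bdd unfolding bounded_any_center[of _ V] dist_norm by blast
    have "X \<noteq> 0"
      using c(1) c(2)[OF U(1)] U(2) by (auto simp: mult_le_0_iff)
    then have X: "norm X > 0"
      by simp
    have "D \<ge> 0"
      using D[OF V] by simp
    then have "(D + 1) / norm X > 0"
      using X by simp
    then have "norm (V - y ((D + 1) / norm X)) \<le> D"
      using D yP by blast
    moreover have "norm (V - y ((D + 1) / norm X)) = D + 1"
      using X \<open>D \<ge> 0\<close> by (simp add: y_def)
    ultimately show False
      by simp
  qed
  define \<tau> where "\<tau> = Inf Q"
  have bdQ: "bdd_below Q"
    by (rule bdd_belowI[of _ 0]) (auto simp: Q_def)
  have "d0 \<le> \<tau>"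
    unfolding \<tau>_def using \<open>Q \<noteq> {}\<close> d0(2) by (intro cInf_greatest) (force simp: Q_def)+
  then have \<tau>: "\<tau> > 0"
    using d0(1) by simp
  have before: "B \<subseteq> strict (y t)" if "0 < t" "t < \<tau>" for t
    using cInf_lower[OF _ bdQ, of t] that unfolding \<tau>_def Q_def by fastforce

  have "\<forall>\<^sub>F s in at \<tau>. (\<forall>S\<in>Pow N. \<forall>n\<in>N. independent S \<longrightarrow>
     (0 < cvar b S n (y \<tau>) \<longrightarrow> 0 < cvar b S n (y s)) \<and>
     (cvar b S n (y \<tau>) < 0 \<longrightarrow> cvar b S n (y s) < 0)) \<and>
     strict (y s) = strict (y \<tau>) \<union> entering V X \<tau> s"
    using eventually_cvar_sign[OF generic, of \<tau>] eventually_strict_eq[OF generic \<tau>]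
    unfolding y_def by (rule eventually_conj)
  then obtain d where d: "d > 0" and
    sign: "\<And>s S n. s \<noteq> \<tau> \<Longrightarrow> dist s \<tau> < d \<Longrightarrow> S \<subseteq> N \<Longrightarrow> n \<in> N \<Longrightarrow> independent S \<Longrightarrow>
     (0 < cvar b S n (y \<tau>) \<longrightarrow> 0 < cvar b S n (y s)) \<and>
     (cvar b S n (y \<tau>) < 0 \<longrightarrow> cvar b S n (y s) < 0)" and
    near: "\<And>s. s \<noteq> \<tau> \<Longrightarrow> dist s \<tau> < d \<Longrightarrow> strict (y s) = strict (y \<tau>) \<union> entering V X \<tau> s"
    unfolding eventually_at by fastforce
  \<comment> \<open>A positive parameter shortly before the first event, where all of
    \<open>B\<close> is active and the local description of \<open>strict\<close> at
    \<open>\<tau>\<close> applies.\<close>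
  define s where "s = max (\<tau> - d / 2) (\<tau> / 2)"
  have s: "0 < s" "s < \<tau>" "dist s \<tau> < d"
    using \<tau> d by (auto simp: s_def dist_real_def)
  have Bs: "B \<subseteq> strict (y s)"
    using before s by simp
  have weak: "S \<in> weak (y \<tau>)" if S: "S \<in> B" for S
  proof -
    have "0 \<le> cvar b S n (y \<tau>)" if n: "n \<in> N" for n
    proof (rule ccontr)
      assume "\<not> 0 \<le> cvar b S n (y \<tau>)"
      then have "cvar b S n (y s) < 0"
        using sign[of s S n] s n B_ind[OF S] by auto
      moreover have "0 < cvar b S n (y s)"
        using Bs S n by (auto simp: strict_def)
      ultimately show False
        by simp
    qed
    then show ?thesis
      using B_ind[OF S] by (simp add: weak_def)
  qed
  \<comment> \<open>Otherwise \<open>B\<close> would stay active up to \<open>\<tau> + d\<close>,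
    beyond the infimum of \<open>Q\<close>.\<close>
  have "\<not> B \<subseteq> strict (y \<tau>)"
  proof
    assume B: "B \<subseteq> strict (y \<tau>)"
    have "B \<subseteq> strict (y t)" if "0 < t" "t < \<tau> + d" for t
    proof (cases "t < \<tau>")
      case False
      then show ?thesis
        using B near[of t] that by (cases "t = \<tau>") (auto simp: dist_real_def)
    qed (use before that in auto)
    then have "\<tau> + d \<le> Inf Q"
      using \<open>Q \<noteq> {}\<close> by (intro cInf_greatest) (force simp: Q_def)+
    then show False
      using d by (simp add: \<tau>_def)
  qed
  then obtain S i where S: "S \<in> B" and i: "i \<in> N" "cvar b S i (y \<tau>) = 0"
    using weak by (force simp: strict_def weak_def)
  \<comment> \<open>The neighbour that shares the event with \<open>S\<close>, and therefore is
    active at \<open>s\<close> as well.\<close>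
  define S' where "S' = toggle i S"
  note tog = toggle_mem_weak[OF weak[OF S] i, folded S'_def]
  have "0 < cvar b S i (y s)"
    using Bs S i by (auto simp: strict_def)
  then have "S' \<in> entering V X \<tau> s"
    using toggle_mem_entering[OF generic, of S \<tau> i s] weak[OF S] i by (simp add: S'_def y_def)
  then have S's: "S' \<in> strict (y s)"
    using near[of s] s by auto

  \<comment> \<open>A foot \<open>U\<close> on a face through \<open>V\<close> gives a right angle
    at \<open>U\<close>, so by Pythagoras \<open>y \<tau>\<close> is at least as far from
    \<open>V\<close> as \<open>U\<close> is. As \<open>U\<close> is farthest in \<open>poly\<close>,
    this forces \<open>y \<tau> = U\<close>; then the slacks of all constraints in \<open>C\<close>
    vanish for the active set \<open>{}\<close>, against uniqueness of the vanishing
    variable.\<close>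
  have no_foot_U: False if T: "T \<subseteq> A" "T \<in> weak (y \<tau>)" and f: "foot b T (y \<tau>) = U" for T
  proof -
    have "(U - V) \<bullet> n = 0" if "n \<in> T" for n
    proof -
      have "n \<bullet> V = b n" "n \<bullet> U = b n"
        using that T subset_tight_foot[OF T(2)] f by (auto simp: A_def tight_def)
      then show ?thesis
        by (simp add: inner_diff_right inner_commute[of _ n])
    qed
    then have "(U - V) \<bullet> (U - y \<tau>) = 0"
      unfolding f[symmetric] foot_expansion[OF indA[OF T(1)]] by (simp add: inner_sum_right)
    then have "(norm (y \<tau> - V))\<^sup>2 = (norm (U - V))\<^sup>2 + (norm (U - y \<tau>))\<^sup>2"
      using norm_add_Pythagorean[of "U - V" "y \<tau> - U"]
      by (simp add: orthogonal_def inner_diff_right norm_minus_commute)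
    moreover have "y \<tau> \<in> poly"
      using foot_mem_poly[of "{}" "y \<tau>"] weak by (simp add: B_def)
    then have "(norm (y \<tau> - V))\<^sup>2 \<le> (norm (U - V))\<^sup>2"
      using U(3)[of "y \<tau>"] by (simp add: dist_norm norm_minus_commute)
    ultimately have yU: "y \<tau> = U"
      by simp
    have "m = n" if "m \<in> C" "n \<in> C" for m n
    proof (rule cvar_line_zero_unique[OF generic _ \<tau>])
      show "{} \<in> weak (V - \<tau> *\<^sub>R X)"
        using weak[of "{}"] by (simp add: B_def y_def)
      show "m \<in> N" "n \<in> N"
        using that CN by auto
      show "cvar b {} m (V - \<tau> *\<^sub>R X) = 0" "cvar b {} n (V - \<tau> *\<^sub>R X) = 0"
        using that yU by (auto simp: cvar_def y_def C_def tight_def)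
    qed
    then show False
      using C(3) unfolding C_def by blast
  qed
  have S'B: "S' \<notin> B"
  proof
    assume S'B: "S' \<in> B"
    have "S' \<noteq> S"
      by (auto simp: S'_def toggle_def)
    \<comment> \<open>Two neighbours inside \<open>Pow A\<close> would differ by an element of
      \<open>A\<close>, whose variable is still positive. If one of them is \<open>C\<close>, then
      the shared foot is \<open>U\<close>, which \<open>no_foot_U\<close> excludes.\<close>
    consider "S \<subseteq> A" "S' \<subseteq> A" | "S = C" "S' \<subseteq> A" | "S \<subseteq> A" "S' = C"
      using S S'B \<open>S' \<noteq> S\<close> by (auto simp: B_def)
    then show False
    proof cases
      case 1
      then have "i \<in> A"
        by (auto simp: S'_def toggle_def split: if_splits)
      then have "0 < \<tau> * cvar b S i (V - X)"
        using 1 pos \<tau> by (simp add: A_def)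
      then show False
        using lineA[OF 1(1) \<open>i \<in> A\<close>, of \<tau>] i(2) by simp
    next
      case 2
      then show False
        using no_foot_U[of S'] tog footC by simp
    next
      case 3
      then show False
        using no_foot_U[of S] weak[OF S] tog(3) footC by simp
    qed
  qed
  have "card (insert S' B) \<le> card (strict (y s))"
    using S's Bs by (intro card_mono finite_strict) auto
  moreover have "card (insert S' B) = 2 ^ card A + 2"
    using S'B finA cardB by (simp add: B_def)
  moreover have "odd (card (strict (y s)))"
    unfolding y_def
  proof (rule odd_card_strict[OF generic bdd _ c V s(1)])
    fix t :: real
    assume t: "t > 0"
    have "0 < cvar b A n (y t)" if n: "n \<in> N" for n
    proof (cases "n \<in> A")
      case True
      then show ?thesis
        using lineA[of A n t] pos t by (simp add: A_def)
    next
      case False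
      have "foot b A (y t) = V"
      proof (rule foot_unique(1)[OF indA[OF order_refl]])
        have "X \<in> span A"
          using A(2) by (simp add: A_def)
        then have "t *\<^sub>R (\<Sum>n\<in>A. (dual_vec A n \<bullet> X) *\<^sub>R n) = t *\<^sub>R X"
          using dual_vec_expansion[OF indA[OF order_refl], of X] by simp
        then show "V - y t = (\<Sum>n\<in>A. (t * (dual_vec A n \<bullet> X)) *\<^sub>R n)"
          by (simp add: y_def scaleR_sum_right)
      qed (auto simp: A_def tight_def)
      moreover have "n \<bullet> V \<le> b n" "n \<bullet> V \<noteq> b n"
        using V n False by (auto simp: poly_def A_def tight_def)
      ultimately show ?thesis
        using False by (simp add: cvar_def)
    qed
    then show "tight V \<in> strict (V - t *\<^sub>R X)"
      using indA AN by (simp add: strict_def A_def y_def)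
  qed
  \<comment> \<open>Even because \<open>A\<close> is nonempty. An odd number that is at least
    \<open>2 ^ card A + 2\<close> is therefore at least one more.\<close>
  moreover have "even ((2::nat) ^ card A + 2)"
    using A(3) finA by (simp add: A_def card_gt_0_iff)
  ultimately have "2 ^ card A + 3 \<le> card (strict (y s))"
    by (cases "card (strict (y s)) = 2 ^ card A + 2") auto
  then show ?thesis
    using Bs by (auto simp: B_def A_def)
qed

end

section \<open>Normals and active sets\<close>

locale simple_halfspaces3 = simple_halfspaces N b
  for N :: "(real^3) set" and b :: "real^3 \<Rightarrow> real"
begin

text \<open>The part \<open>w\<close> of \<open>z - y\<close> orthogonal to the plane normal
  \<open>a\<close> is a direction of the plane, so it vanishes. Thus \<open>z - y\<close> is a
  multiple of \<open>a\<close>, with nonnegative factor because \<open>y\<close> lies on the side of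
  \<open>P\<close>.\<close>

lemma support_plane_normal_le:
  assumes sp: "support_plane P h" and z: "z \<in> h \<inter> P" and y: "y \<in> P" and p: "p \<in> P"
    and perp: "\<forall>u\<in>h. \<forall>v\<in>h. orthogonal (z - y) (u - v)"
  shows "(p - z) \<bullet> (z - y) \<le> 0"
proof -
  obtain a \<beta> where a: "a \<noteq> 0" "h = {x. a \<bullet> x = \<beta>}" "P \<subseteq> {x. a \<bullet> x \<le> \<beta>}"
    using sp unfolding support_plane_def by blast
  define c where "c = (a \<bullet> (z - y)) / (a \<bullet> a)"
  define w where "w = z - y - c *\<^sub>R a"
  have aw: "a \<bullet> w = 0"
    using a(1) by (simp add: w_def c_def inner_diff_right)
  then have "z + w \<in> h" "z \<in> h"
    using z a(2) by (auto simp: inner_add_right)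
  then have "(z - y) \<bullet> w = 0"
    using perp by (force simp: orthogonal_def)
  then have "w \<bullet> w = 0"
    using aw by (simp add: w_def inner_diff_left)
  then have zy: "z - y = c *\<^sub>R a"
    by (simp add: w_def)
  have "a \<bullet> z = \<beta>" "a \<bullet> y \<le> \<beta>" "a \<bullet> p \<le> \<beta>"
    using a z y p by auto
  then have "c \<ge> 0" and "a \<bullet> (p - z) \<le> 0"
    by (auto simp: c_def inner_diff_right)
  then show ?thesis
    by (simp add: zy mult_nonneg_nonpos inner_commute[of "p - z"])
qed

text \<open>Points with the same tight constraints lie in the relative interior of the same face, so
  the segment between them can be prolonged slightly at either end inside \<open>poly\<close>.
  Testing both inequalities at such prolongations and adding them gives
  \<open>(norm (z - z'))\<^sup>2 \<le> 0\<close>.\<close>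

lemma normal_foot_unique:
  assumes z: "z \<in> poly" "\<And>p. p \<in> poly \<Longrightarrow> (p - z) \<bullet> (z - y) \<le> 0"
    and z': "z' \<in> poly" "\<And>p. p \<in> poly \<Longrightarrow> (p - z') \<bullet> (z' - y) \<le> 0"
    and eq: "tight z = tight z'"
  shows "z = z'"
proof -
  have *: "(u - u') \<bullet> (u - y) \<le> 0"
    if u: "u \<in> poly" "\<And>p. p \<in> poly \<Longrightarrow> (p - u) \<bullet> (u - y) \<le> 0"
      and u': "tight u = tight u'" for u u'
  proof -
    have "\<forall>\<^sub>F e in at_right 0. n \<bullet> (u + e *\<^sub>R (u - u')) \<le> b n" if n: "n \<in> N" for n
    proof (cases "n \<in> tight u")
      case True
      then have "n \<bullet> u = b n" "n \<bullet> u' = b n"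
        using u' by (auto simp: tight_def)
      then show ?thesis
        by (simp add: inner_add_right inner_diff_right)
    next
      case False
      then have "n \<bullet> (u + 0 *\<^sub>R (u - u')) < b n"
        using u(1) n by (auto simp: tight_def poly_def less_le)
      moreover have "((\<lambda>e. n \<bullet> (u + e *\<^sub>R (u - u'))) \<longlongrightarrow> n \<bullet> (u + 0 *\<^sub>R (u - u'))) (at_right 0)"
        by (intro tendsto_intros)
      ultimately have "\<forall>\<^sub>F e in at_right 0. n \<bullet> (u + e *\<^sub>R (u - u')) < b n"
        using order_tendstoD(2) by blast
      then show ?thesis
        by (rule eventually_mono) simp
    qed
    then have "\<forall>\<^sub>F e in at_right 0. \<forall>n\<in>N. n \<bullet> (u + e *\<^sub>R (u - u')) \<le> b n"
      using finite_N by (simp add: eventually_ball_finite_distrib)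
    then have "\<forall>\<^sub>F e in at_right 0. 0 < e \<and> u + e *\<^sub>R (u - u') \<in> poly"
      using eventually_at_right_less[of "0::real"] by eventually_elim (simp add: poly_def)
    then obtain e :: real where e: "e > 0" "u + e *\<^sub>R (u - u') \<in> poly"
      using eventually_happens' trivial_limit_at_right_real by blast
    then have "e * ((u - u') \<bullet> (u - y)) \<le> 0"
      using u(2)[OF e(2)] by simp
    then show ?thesis
      using e(1) by (simp add: mult_le_0_iff)
  qed
  have "(z - z') \<bullet> (z - y) \<le> 0" "(z' - z) \<bullet> (z' - y) \<le> 0"
    using *[OF z eq] *[OF z' eq[symmetric]] by blast+
  moreover have "(z - z') \<bullet> (z - z') = (z - z') \<bullet> (z - y) + (z' - z) \<bullet> (z' - y)"
    by (simp add: inner_diff_left inner_diff_right algebra_simps)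
  ultimately have "(norm (z - z'))\<^sup>2 \<le> 0"
    by (simp add: dot_square_norm)
  then show ?thesis
    by simp
qed

text \<open>This embeds the normals into the subsets of \<open>N\<close>. The resulting finiteness
  and uniform bound are what make \<open>card\<close> and \<open>Max\<close> in
  \<open>num_normals\<close> and \<open>max_normals\<close> meaningful.\<close>

lemma normals_subset:
  assumes "y \<in> poly"
  shows "\<exists>Z. normals poly y \<subseteq> closed_segment y ` Z \<and> inj_on tight Z \<and> tight ` Z \<subseteq> Pow N"
proof -
  define Z where "Z = {z \<in> poly. \<forall>p\<in>poly. (p - z) \<bullet> (z - y) \<le> 0}"
  have "normals poly y \<subseteq> closed_segment y ` Z"
    using support_plane_normal_le[OF _ _ assms] unfolding normals_def Z_def by blast
  moreover have "inj_on tight Z"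
    by (rule inj_onI) (auto simp: Z_def intro: normal_foot_unique)
  moreover have "tight ` Z \<subseteq> Pow N"
    by (auto simp: tight_def)
  ultimately show ?thesis
    by blast
qed

lemma finite_normals: "y \<in> poly \<Longrightarrow> finite (normals poly y)"
  and num_normals_le: "y \<in> poly \<Longrightarrow> num_normals poly y \<le> card (Pow N)"
proof -
  assume "y \<in> poly"
  from normals_subset[OF this] obtain Z
    where Z: "normals poly y \<subseteq> closed_segment y ` Z" "inj_on tight Z" "tight ` Z \<subseteq> Pow N"
    by (elim exE conjE)
  have "finite (tight ` Z)"
    by (rule finite_subset[OF Z(3)]) (simp add: finite_N)
  then have "finite Z"
    using Z(2) by (rule finite_imageD)
  then show "finite (normals poly y)"
    using Z(1) finite_subset[of _ "closed_segment y ` Z"] by simp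
  have "card (normals poly y) \<le> card Z"
    using \<open>finite Z\<close> Z(1) by (rule surj_card_le)
  also have "\<dots> \<le> card (Pow N)"
    using Z finite_N by (intro card_inj_on_le[of tight]) auto
  finally show "num_normals poly y \<le> card (Pow N)"
    by (simp add: num_normals_def)
qed

lemma num_normals_le_max_normals:
  assumes "y \<in> interior poly"
  shows "num_normals poly y \<le> max_normals poly"
  unfolding max_normals_def
proof (rule Max_ge)
  have "num_normals poly ` interior poly \<subseteq> {..card (Pow N)}"
    using num_normals_le interior_subset by blast
  then show "finite (num_normals poly ` interior poly)"
    using finite_subset by blast
qed (use assms in simp)

lemma interior_poly:
  assumes "{} \<in> strict y"
  shows "y \<in> interior poly"
proof (rule interiorI)
  show "open (\<Inter>n\<in>N. {z. n \<bullet> z < b n})"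
    using finite_N by (intro open_INT ballI open_halfspace_lt)
  show "y \<in> (\<Inter>n\<in>N. {z. n \<bullet> z < b n})"
    using assms by (simp add: strict_def cvar_def)
  show "(\<Inter>n\<in>N. {z. n \<bullet> z < b n}) \<subseteq> poly"
    by (auto simp: poly_def less_imp_le)
qed

text \<open>Nonnegative multipliers make \<open>z - y\<close> an outer normal at the foot
  \<open>z\<close>, so the plane through \<open>z\<close> orthogonal to it supports
  \<open>poly\<close>. A positive multiplier, present because \<open>S\<close> is nonempty, ensures
  \<open>z \<noteq> y\<close>.\<close>

lemma foot_segment_in_normals:
  assumes S: "S \<in> strict y" "S \<noteq> {}"
  shows "closed_segment y (foot b S y) \<in> normals poly y"
proof -
  define z where "z = foot b S y"
  have ind: "independent S" "S \<subseteq> N"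
    using S by (auto simp: strict_def)
  have z: "z \<in> poly"
    unfolding z_def using S strict_subset_weak by (intro foot_mem_poly) auto
  have le: "(p - z) \<bullet> (z - y) \<le> 0" if p: "p \<in> poly" for p
  proof -
    have "(p - z) \<bullet> (z - y) = (\<Sum>n\<in>S. cvar b S n y * ((p - z) \<bullet> n))"
      unfolding z_def foot_expansion[OF ind(1)] by (simp add: inner_sum_right)
    also have "\<dots> \<le> 0"
    proof (intro sum_nonpos mult_nonneg_nonpos)
      fix n assume n: "n \<in> S"
      show "0 \<le> cvar b S n y"
        using S n by (force simp: strict_def)
      have "n \<bullet> p \<le> b n" "n \<bullet> z = b n"
        using p n ind inner_foot[OF ind(1) n] by (auto simp: poly_def z_def)
      then show "(p - z) \<bullet> n \<le> 0"
        by (simp add: inner_commute[of _ n] inner_diff_right)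
    qed
    finally show ?thesis .
  qed
  have "z \<noteq> y"
  proof
    assume "z = y"
    obtain n where n: "n \<in> S"
      using S(2) by blast
    then have "cvar b S n y = 0"
      using \<open>z = y\<close> by (simp add: cvar_def z_def)
    then show False
      using S n by (force simp: strict_def)
  qed
  define h where "h = {x. (z - y) \<bullet> x = (z - y) \<bullet> z}"
  have "support_plane poly h"
    unfolding support_plane_def h_def
  proof (intro exI conjI)
    show "z - y \<noteq> 0"
      using \<open>z \<noteq> y\<close> by simp
    show "poly \<subseteq> {x. (z - y) \<bullet> x \<le> (z - y) \<bullet> z}"
    proof
      fix p assume "p \<in> poly"
      then have "(z - y) \<bullet> (p - z) \<le> 0"
        using le by (simp add: inner_commute)
      then show "p \<in> {x. (z - y) \<bullet> x \<le> (z - y) \<bullet> z}"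
        by (simp add: inner_diff_right)
    qed
    show "{x. (z - y) \<bullet> x = (z - y) \<bullet> z} \<inter> poly \<noteq> {}"
      using z by blast
  qed (rule refl)
  moreover have "z \<in> h \<inter> poly"
    using z by (simp add: h_def)
  moreover have "\<forall>u\<in>h. \<forall>v\<in>h. orthogonal (z - y) (u - v)"
    by (simp add: h_def orthogonal_def inner_diff_right)
  ultimately show ?thesis
    unfolding normals_def z_def[symmetric] by blast
qed

text \<open>The extra 1 accounts for the empty active set, whose foot is \<open>y\<close> itself.
  The other active sets have distinct feet, since each is recovered as the tight set of its
  foot.\<close>

lemma card_strict_le:
  assumes "{} \<in> strict y"
  shows "card (strict y) \<le> Suc (num_normals poly y)"
proof -
  have y: "y \<in> poly"
    using interior_poly[OF assms] interior_subset by blast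
  have "inj_on (\<lambda>S. closed_segment y (foot b S y)) (strict y - {{}})"
  proof (rule inj_onI)
    fix S T assume S: "S \<in> strict y - {{}}" and T: "T \<in> strict y - {{}}"
      and eq: "closed_segment y (foot b S y) = closed_segment y (foot b T y)"
    then have "foot b S y = foot b T y"
      by (auto simp: closed_segment_eq doubleton_eq_iff)
    then show "S = T"
      using tight_foot_eq S T by (metis DiffD1)
  qed
  then have "card (strict y - {{}}) \<le> card (normals poly y)"
    using foot_segment_in_normals finite_normals[OF y] by (intro card_inj_on_le) auto
  then show ?thesis
    using assms finite_strict[of y] by (simp add: num_normals_def)
qed

end

section \<open>Biorthogonal families and positivity of the variables at a nice vertex\<close>

definition biorthogonal :: "(3 \<Rightarrow> real^3) \<Rightarrow> (3 \<Rightarrow> real^3) \<Rightarrow> bool" where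
  "biorthogonal a e \<longleftrightarrow> (\<forall>i j. a i \<bullet> e j = 0 \<longleftrightarrow> i \<noteq> j)"

lemma biorthogonal_sym: "biorthogonal a e \<Longrightarrow> biorthogonal e a"
  unfolding biorthogonal_def by (metis inner_commute)

text \<open>Pairing a vanishing combination of the \<open>a i\<close> with \<open>e i\<close>
  isolates the coefficient of \<open>a i\<close>.\<close>

lemma biorthogonal_basis:
  assumes "biorthogonal a e"
  shows "inj a" "independent (range a)" "span (range a) = UNIV" "card (range a) = 3"
proof -
  show inj: "inj a"
    using assms unfolding biorthogonal_def inj_def by metis
  then show card: "card (range a) = 3"
    by (simp add: card_image)
  show ind: "independent (range a)"
    unfolding independent_explicit
  proof (intro conjI allI impI ballI)
    fix u v
    assume "(\<Sum>v\<in>range a. u v *\<^sub>R v) = 0" and "v \<in> range a"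
    then obtain i where i: "v = a i" and 0: "(\<Sum>j\<in>UNIV. u (a j) *\<^sub>R a j) = 0"
      using inj by (auto simp: sum.reindex)
    have "(\<Sum>j\<in>UNIV. u (a j) *\<^sub>R a j) \<bullet> e i = (\<Sum>j\<in>UNIV. if j = i then u (a i) * (a i \<bullet> e i) else 0)"
      unfolding inner_sum_left using assms by (intro sum.cong) (auto simp: biorthogonal_def)
    then have "u (a i) * (a i \<bullet> e i) = 0"
      using 0 by simp
    then show "u v = 0"
      using assms i by (auto simp: biorthogonal_def)
  qed simp
  show "span (range a) = UNIV"
    using ind card by (simp add: dim_eq_full[symmetric] dim_eq_card_independent)
qed

lemma biorthogonal_eq_0:
  assumes "biorthogonal a e" "\<And>i. a i \<bullet> v = 0"
  shows "v = 0"
  using biorthogonal_basis(3)[OF assms(1)] assms(2)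
  by (intro span_orthogonal_eq_0[of v "range a"]) auto

lemma biorthogonal_expansion:
  assumes "biorthogonal a e"
  shows "v = (\<Sum>i\<in>UNIV. ((v \<bullet> e i) / (a i \<bullet> e i)) *\<^sub>R a i)"
proof -
  have "e j \<bullet> (v - (\<Sum>i\<in>UNIV. ((v \<bullet> e i) / (a i \<bullet> e i)) *\<^sub>R a i)) = 0" for j
  proof -
    have "(\<Sum>i\<in>UNIV. ((v \<bullet> e i) / (a i \<bullet> e i)) * (e j \<bullet> a i)) =
          (\<Sum>i\<in>UNIV. if i = j then v \<bullet> e j else 0)"
      using assms by (intro sum.cong refl) (auto simp: biorthogonal_def inner_commute[of "e j"])
    then show ?thesis
      by (simp add: inner_diff_right inner_sum_right inner_commute)
  qed
  from biorthogonal_eq_0[OF biorthogonal_sym[OF assms] this] show ?thesis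
    by simp
qed

text \<open>Niceness in terms of inner products, in strict form: \<open>X\<close> is inside the
  normal cone, at spherical distance below a right angle from each \<open>a i\<close>. The last
  clause, used for both orders of \<open>i\<close> and \<open>j\<close>, says that the projection of
  \<open>X\<close> to the plane of \<open>a i\<close> and \<open>a j\<close> has positive
  coefficients.\<close>

definition nice_dir :: "(3 \<Rightarrow> real^3) \<Rightarrow> (3 \<Rightarrow> real^3) \<Rightarrow> real^3 \<Rightarrow> bool" where
  "nice_dir a e X \<longleftrightarrow> (\<forall>i. X \<bullet> e i < 0 \<and> 0 < X \<bullet> a i \<and>
     (\<forall>j. i \<noteq> j \<longrightarrow> (a i \<bullet> a j) * (X \<bullet> a i) < X \<bullet> a j))"

lemma subset_3_cases:
  fixes I :: "3 set"
  obtains "I = {}" | i where "I = {i}" | k where "I = - {k}" | "I = UNIV"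
proof -
  have "I = {} \<or> I = {1} \<or> I = {2} \<or> I = {3} \<or> I = - {1} \<or> I = - {2} \<or> I = - {3} \<or> I = UNIV"
    unfolding set_eq_iff forall_3 by (cases "1 \<in> I"; cases "2 \<in> I"; cases "3 \<in> I") auto
  then show ?thesis
    using that by blast
qed

lemma Compl_singleton_3:
  fixes k :: 3
  obtains i j where "i \<noteq> j" "i \<noteq> k" "j \<noteq> k" "- {k} = {i, j}"
proof -
  have "\<exists>i j. i \<noteq> j \<and> i \<noteq> k \<and> j \<noteq> k \<and> - {k} = {i, j}"
    using exhaust_3[of k] unfolding set_eq_iff forall_3
    by (elim disjE) (rule exI[of _ 2] exI[of _ 1], rule exI[of _ 3] exI[of _ 2], simp)+
  then show ?thesis
    using that by blast
qed

text \<open>For each size of \<open>I\<close> the foot is explicit: \<open>V - X\<close>, its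
  projection to a facet plane, its projection to an edge line, or \<open>V\<close>. The variables
  are positive by the clauses of \<open>nice_dir\<close>: \<open>X \<bullet> a i\<close> for slacks
  of \<open>{}\<close> and multipliers of facets, the mixed clause for slacks of facets and
  multipliers of edges, \<open>X \<bullet> e i\<close> for slacks of edges and multipliers of the
  vertex.\<close>

lemma cvar_nice_dir_pos:
  assumes bi: "biorthogonal a e" and neg: "\<And>i. a i \<bullet> e i < 0" and unit: "\<And>i. norm (a i) = 1"
    and b: "\<And>i. b (a i) = a i \<bullet> V" and X: "nice_dir a e X"
  shows "0 < cvar b (a ` I) (a m) (V - X)"
proof -
  have ind: "independent (a ` I)"
    using biorthogonal_basis(2)[OF bi] by (rule independent_mono) auto
  have inj: "a i = a j \<longleftrightarrow> i = j" for i j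
    using biorthogonal_basis(1)[OF bi] by (auto dest: injD)
  have aa: "a i \<bullet> a i = 1" for i
    using unit by (simp add: dot_square_norm)
  have ae: "a i \<bullet> e j = 0" if "i \<noteq> j" for i j
    using bi that by (simp add: biorthogonal_def)
  note Xe = X[unfolded nice_dir_def, rule_format]
  show ?thesis
  proof (cases I rule: subset_3_cases)
    case 1
    then show ?thesis
      using b Xe by (simp add: cvar_def foot_def inner_diff_right inner_commute)
  next
    case (2 i)
    define z where "z = V - X + (X \<bullet> a i) *\<^sub>R a i"
    have eq: "z - (V - X) = (\<Sum>n\<in>a ` I. (X \<bullet> a i) *\<^sub>R n)"
      by (simp add: 2 z_def)
    have tight: "n \<bullet> z = b n" if "n \<in> a ` I" for n
      using that 2 b aa by (auto simp: z_def inner_add_right inner_diff_right inner_commute)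
    note u = foot_unique[OF ind eq tight]
    show ?thesis
    proof (cases "m = i")
      case True
      then show ?thesis
        using u(2)[of "a i"] 2 Xe by simp
    next
      case False
      then have "0 < b (a m) - a m \<bullet> z"
        using Xe[of i, THEN conjunct2, THEN conjunct2, rule_format, of m] b
        by (simp add: z_def inner_add_right inner_diff_right inner_commute mult.commute)
      then show ?thesis
        using False u(1) 2 inj by (simp add: cvar_def)
    qed
  next
    case (3 k)
    obtain i j where ij: "i \<noteq> j" "i \<noteq> k" "j \<noteq> k" "- {k} = {i, j}"
      by (rule Compl_singleton_3)
    define c where "c = a i \<bullet> a j"
    have "(a i - c *\<^sub>R a j) \<bullet> e i \<noteq> 0"
      using neg[of i] ae[of j i] ij by (simp add: inner_diff_left)
    then have "a i - c *\<^sub>R a j \<noteq> 0"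
      by auto
    then have "(a i - c *\<^sub>R a j) \<bullet> (a i - c *\<^sub>R a j) > 0"
      by simp
    then have c: "1 - c * c > 0"
      by (simp add: inner_diff_left inner_diff_right aa c_def inner_commute)
    \<comment> \<open>The solution of the Gram system for projecting \<open>X\<close> to the span of
      \<open>a i\<close> and \<open>a j\<close>.\<close>
    define li lj where "li = (X \<bullet> a i - c * (X \<bullet> a j)) / (1 - c * c)"
      and "lj = (X \<bullet> a j - c * (X \<bullet> a i)) / (1 - c * c)"
    have "c * (X \<bullet> a i) < X \<bullet> a j" "c * (X \<bullet> a j) < X \<bullet> a i"
      using Xe[of i, THEN conjunct2, THEN conjunct2, rule_format, OF ij(1)]
        Xe[of j, THEN conjunct2, THEN conjunct2, rule_format, OF ij(1)[symmetric]]
      by (simp_all add: c_def inner_commute[of "a j"])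
    then have l: "li > 0" "lj > 0"
      using c by (simp_all add: li_def lj_def)
    define w where "w = li *\<^sub>R a i + lj *\<^sub>R a j - X"
    have "li * (1 - c * c) = X \<bullet> a i - c * (X \<bullet> a j)" "lj * (1 - c * c) = X \<bullet> a j - c * (X \<bullet> a i)"
      using c by (simp_all add: li_def lj_def)
    then have "(li + lj * c) * (1 - c * c) = (X \<bullet> a i) * (1 - c * c)"
      "(li * c + lj) * (1 - c * c) = (X \<bullet> a j) * (1 - c * c)"
      by algebra+
    then have "li + lj * c = X \<bullet> a i" "li * c + lj = X \<bullet> a j"
      using c by simp_all
    then have w0: "a i \<bullet> w = 0" "a j \<bullet> w = 0"
      by (simp_all add: w_def inner_add_right inner_diff_right aa c_def inner_commute)
    have eq: "(V + w) - (V - X) = (\<Sum>n\<in>a ` I. (if n = a i then li else lj) *\<^sub>R n)"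
      using ij inj by (simp add: 3 w_def)
    have tight: "n \<bullet> (V + w) = b n" if "n \<in> a ` I" for n
      using that 3 ij b w0 by (auto simp: inner_add_right)
    note u = foot_unique[OF ind eq tight]
    show ?thesis
    proof (cases "m = k")
      case False
      then show ?thesis
        using u(2)[of "a m"] 3 l by simp
    next
      case True
      \<comment> \<open>Being orthogonal to the other two normals, \<open>w\<close> is a multiple of
        the edge vector \<open>e k\<close>. The factor is positive because
        \<open>X \<bullet> e k < 0\<close>, so the foot lies on the side of \<open>V\<close> to
        which the edge extends.\<close>
      define \<mu> where "\<mu> = (w \<bullet> a k) / (e k \<bullet> a k)"
      have w: "w = \<mu> *\<^sub>R e k"
      proof -
        have "a l \<bullet> (w - \<mu> *\<^sub>R e k) = 0" for l
        proof (cases "l = k")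
          case True
          then show ?thesis
            using neg[of k] by (simp add: \<mu>_def inner_diff_right inner_commute)
        next
          case False
          then have "l \<in> {i, j}"
            unfolding ij(4)[symmetric] by simp
          then show ?thesis
            using w0 ae[OF False] by (auto simp: inner_diff_right)
        qed
        from biorthogonal_eq_0[OF bi this] show ?thesis
          by simp
      qed
      have "w \<bullet> e k = - (X \<bullet> e k)"
        using ae[OF ij(2)] ae[OF ij(3)] by (simp add: w_def inner_diff_left inner_add_left)
      then have "\<mu> * (e k \<bullet> e k) > 0"
        using Xe[of k] by (simp add: w)
      then have "\<mu> > 0"
        using inner_ge_zero[of "e k"] mult_nonpos_nonneg[of \<mu> "e k \<bullet> e k"] by linarith
      then have "0 < b (a m) - a m \<bullet> (V + w)"
        using neg[of k] b True by (simp add: w inner_add_right mult_pos_neg)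
      then show ?thesis
        using True u(1) 3 inj by (auto simp: cvar_def)
    qed
  next
    case 4
    have "X = (\<Sum>i\<in>UNIV. ((X \<bullet> e i) / (a i \<bullet> e i)) *\<^sub>R a i)"
      by (rule biorthogonal_expansion[OF bi])
    also have "\<dots> = (\<Sum>n\<in>range a. ((X \<bullet> e (inv a n)) / (n \<bullet> e (inv a n))) *\<^sub>R n)"
      using biorthogonal_basis(1)[OF bi] by (simp add: sum.reindex)
    finally have eq: "V - (V - X) = (\<Sum>n\<in>a ` I. ((X \<bullet> e (inv a n)) / (n \<bullet> e (inv a n))) *\<^sub>R n)"
      using 4 by simp
    have "n \<bullet> V = b n" if "n \<in> a ` I" for n
      using that b by auto
    from foot_unique(2)[OF ind eq this, of "a m"]
    have "cvar b (a ` I) (a m) (V - X) = (X \<bullet> e m) / (a m \<bullet> e m)"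
      using 4 biorthogonal_basis(1)[OF bi] by simp
    then show ?thesis
      using Xe[of m] neg[of m] by (simp add: divide_neg_neg)
  qed
qed

section \<open>Edges at a simple vertex\<close>

text \<open>The tangent cone of a simple vertex: unit outer facet normals \<open>a i\<close> and
  edge vectors \<open>e i\<close>, numbered so that facet \<open>i\<close> contains the edges other
  than \<open>e i\<close>. The length of \<open>e i\<close> is left free; \<open>V + e i\<close> may
  be any point of the edge except \<open>V\<close>.\<close>

definition vertex_frame :: "(real^3) set \<Rightarrow> real^3 \<Rightarrow> (3 \<Rightarrow> real^3) \<Rightarrow> (3 \<Rightarrow> real^3) \<Rightarrow> bool" where
  "vertex_frame P V a e \<longleftrightarrow> biorthogonal a e \<and> V \<in> P \<and>
     (\<forall>i. a i \<bullet> e i < 0 \<and> norm (a i) = 1 \<and> V + e i \<in> P \<and> (\<forall>p\<in>P. a i \<bullet> (p - V) \<le> 0))"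

lemma extreme_point_of_convex_comb:
  assumes "q extreme_point_of Q" "x \<in> Q" "y \<in> Q" "q = (1 - u) *\<^sub>R x + u *\<^sub>R y" "0 < u" "u < 1"
  shows "x = q \<and> y = q"
proof (cases "x = y")
  case True
  then show ?thesis
    using assms(4) by (simp add: scaleR_left_distrib[symmetric])
next
  case False
  then have "q \<in> open_segment x y"
    using assms by (auto simp: in_segment)
  then show ?thesis
    using assms by (auto simp: extreme_point_of_def)
qed

lemma convex_ray_add:
  fixes V :: "'a::real_vector"
  assumes "convex Q" "q1 \<in> Q" "q2 \<in> Q" "0 \<le> s1" "0 \<le> s2"
  shows "\<exists>q\<in>Q. s1 *\<^sub>R (q1 - V) + s2 *\<^sub>R (q2 - V) = (s1 + s2) *\<^sub>R (q - V)"
proof (cases "s1 + s2 = 0")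
  case False
  then have pos: "s1 + s2 > 0"
    using assms by simp
  define q where "q = (s1 / (s1 + s2)) *\<^sub>R q1 + (s2 / (s1 + s2)) *\<^sub>R q2"
  have "s1 / (s1 + s2) + s2 / (s1 + s2) = 1"
    using pos by (simp add: add_divide_distrib[symmetric])
  then have "q \<in> Q"
    unfolding q_def using assms pos by (intro convexD) auto
  moreover have "(s1 + s2) *\<^sub>R q = s1 *\<^sub>R q1 + s2 *\<^sub>R q2"
    using pos by (simp add: q_def scaleR_add_right)
  then have "s1 *\<^sub>R (q1 - V) + s2 *\<^sub>R (q2 - V) = (s1 + s2) *\<^sub>R (q - V)"
    by (simp add: algebra_simps)
  ultimately show ?thesis
    by blast
next
  case True
  then have "s1 = 0" "s2 = 0"
    using assms(4,5) by auto
  then show ?thesis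
    using assms(2) by auto
qed

text \<open>The extreme points \<open>q\<close> of the vertex figure \<open>Q\<close> span the edges of \<open>P\<close> at \<open>V\<close>; the functional
  \<open>c\<close> is normalised such that \<open>Q\<close> lies in the plane \<open>c \<bullet> (x - V) = 1\<close>.\<close>

lemma edge_of_vertex_figure:
  fixes P :: "'a::euclidean_space set"
  assumes P: "convex P" and V: "V \<in> P" and Q: "convex Q" "\<And>q. q \<in> Q \<Longrightarrow> c \<bullet> (q - V) = 1"
    and cone: "\<And>p. p \<in> P \<Longrightarrow> \<exists>s\<ge>0. \<exists>q\<in>Q. p = V + s *\<^sub>R (q - V)"
    and q: "q extreme_point_of Q" and w: "w \<in> P" "s > 0" "w = V + s *\<^sub>R (q - V)"
  shows "P \<inter> {V + s *\<^sub>R (q - V) |s. 0 \<le> s} edge_of P"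
proof -
  define R where "R = {V + s *\<^sub>R (q - V) |s. 0 \<le> s}"
  have qQ: "q \<in> Q"
    using q by (simp add: extreme_point_of_def)
  have R: "V + s *\<^sub>R (q - V) \<in> R" if "s \<ge> 0" for s
    using that by (auto simp: R_def)
  have convR: "convex R"
  proof -
    have "R = (\<lambda>x. V + x) ` ((\<lambda>s. s *\<^sub>R (q - V)) ` {0..})"
      by (auto simp: R_def image_iff)
    moreover have "convex ((\<lambda>s. s *\<^sub>R (q - V)) ` {0::real..})"
      by (intro convex_linear_image linearI convex_real_interval) (auto simp: algebra_simps)
    ultimately show ?thesis
      by (simp add: convex_translation)
  qed
  have "P \<inter> R face_of P"
    unfolding face_of_def
  proof (intro conjI ballI impI)
    show "convex (P \<inter> R)"
      using P convR by (rule convex_Int)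
    fix x y z
    assume x: "x \<in> P" and y: "y \<in> P" and z: "z \<in> P \<inter> R" "z \<in> open_segment x y"
    obtain s1 q1 where 1: "0 \<le> s1" "q1 \<in> Q" "x = V + s1 *\<^sub>R (q1 - V)"
      using cone[OF x] by blast
    obtain s2 q2 where 2: "0 \<le> s2" "q2 \<in> Q" "y = V + s2 *\<^sub>R (q2 - V)"
      using cone[OF y] by blast
    obtain m where m: "0 \<le> m" "z = V + m *\<^sub>R (q - V)"
      using z(1) by (auto simp: R_def)
    obtain u where u: "0 < u" "u < 1" "z = (1 - u) *\<^sub>R x + u *\<^sub>R y"
      using z(2) by (auto simp: in_segment)
    define t1 t2 where "t1 = (1 - u) * s1" and "t2 = u * s2"
    have t: "t1 \<ge> 0" "t2 \<ge> 0"
      using 1 2 u by (auto simp: t1_def t2_def)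
    have eq: "m *\<^sub>R (q - V) = t1 *\<^sub>R (q1 - V) + t2 *\<^sub>R (q2 - V)"
    proof -
      have "z - V = (1 - u) *\<^sub>R (x - V) + u *\<^sub>R (y - V)"
        unfolding u(3) by (simp add: algebra_simps)
      then show ?thesis
        unfolding m(2) 1(3) 2(3) by (simp add: t1_def t2_def)
    qed
    \<comment> \<open>Pairing with \<open>c\<close> compares the weights, so that \<open>q\<close>
      becomes a convex combination of \<open>q1\<close> and \<open>q2\<close> and its extremality
      can be used.\<close>
    have m12: "m = t1 + t2"
      using arg_cong[OF eq, of "(\<bullet>) c"] Q(2)[OF qQ] Q(2)[OF 1(2)] Q(2)[OF 2(2)]
      by (simp add: inner_add_right)
    have "(s1 = 0 \<or> q1 = q) \<and> (s2 = 0 \<or> q2 = q)"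
    proof (cases "s1 = 0 \<or> s2 = 0")
      case True
      have "m *\<^sub>R (q - V) = m *\<^sub>R (q2 - V)" if "s1 = 0"
        using that eq m12 by (simp add: t1_def)
      moreover have "m *\<^sub>R (q - V) = m *\<^sub>R (q1 - V)" if "s2 = 0"
        using that eq m12 by (simp add: t2_def)
      ultimately show ?thesis
        using True m12 u by (auto simp: t1_def t2_def)
    next
      case False
      then have t0: "t1 > 0" "t2 > 0"
        using 1 2 u by (auto simp: t1_def t2_def)
      define l where "l = t2 / m"
      have l: "0 < l" "l < 1" "m * l = t2" "m * (1 - l) = t1"
        using t0 by (auto simp: l_def m12 right_diff_distrib)
      have "m *\<^sub>R q = m *\<^sub>R ((1 - l) *\<^sub>R q1 + l *\<^sub>R q2)"
        using eq l(3,4) by (simp add: m12 scaleR_add_right) (simp add: algebra_simps)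
      then have "q = (1 - l) *\<^sub>R q1 + l *\<^sub>R q2"
        using t0 m12 by simp
      from extreme_point_of_convex_comb[OF q 1(2) 2(2) this l(1,2)] show ?thesis
        by blast
    qed
    then have "x \<in> R \<and> y \<in> R"
      using 1 2 R[of 0] R[of s1] R[of s2] by auto
    then show "x \<in> P \<inter> R" "y \<in> P \<inter> R"
      using x y by auto
  qed auto
  moreover have "aff_dim (P \<inter> R) = 1"
  proof -
    have "q \<noteq> V"
      using Q(2)[OF qQ] by auto
    then have Vw: "V \<noteq> w"
      using w by simp
    have "R \<subseteq> affine hull {V, w}"
    proof
      fix x assume "x \<in> R"
      then obtain r where "x = V + r *\<^sub>R (q - V)"
        by (auto simp: R_def)
      then have "x = (1 - r / s) *\<^sub>R V + (r / s) *\<^sub>R w"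
        using w(2) by (simp add: w(3) algebra_simps)
      then show "x \<in> affine hull {V, w}"
        unfolding affine_hull_2 by (intro CollectI exI[of _ "1 - r / s"] exI[of _ "r / s"]) auto
    qed
    then have "aff_dim (P \<inter> R) \<le> aff_dim (affine hull {V, w})"
      by (intro aff_dim_subset) auto
    moreover have "aff_dim {V, w} \<le> aff_dim (P \<inter> R)"
      using R[of 0] R[of s] V w by (intro aff_dim_subset) auto
    ultimately show ?thesis
      using Vw by (simp add: aff_dim_2)
  qed
  ultimately show ?thesis
    by (simp add: edge_of_def R_def)
qed

text \<open>The extreme points of the vertex figure \<open>Q\<close> give distinct edges at
  \<open>V\<close>, so there are at most three by simplicity. Their directions span the space
  because \<open>P\<close> has interior, so there are exactly three and they form a basis; its dual
  basis provides the facet normals.\<close>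

lemma exists_vertex_frame:
  assumes simple: "simple_polytope P" and V: "V extreme_point_of P"
  shows "\<exists>a e. vertex_frame P V a e"
proof -
  have P: "polytope P" "interior P \<noteq> {}" and edges3: "card {E. E edge_of P \<and> V \<in> E} = 3"
    using simple V by (auto simp: simple_polytope_def full_polytope_def)
  have conv: "convex P" and comp: "compact P"
    using P by (auto intro: polytope_imp_convex polytope_imp_compact)
  have VP: "V \<in> P"
    using V by (simp add: extreme_point_of_def)
  define W where "W = {w. w extreme_point_of P} - {V}"
  have fin: "finite W"
    using P(1) by (simp add: W_def finite_polyhedron_extreme_points polytope_imp_polyhedron)
  have hullP: "P = convex hull insert V W"
  proof -
    have "insert V W = {w. w extreme_point_of P}"
      using V by (auto simp: W_def)
    then show ?thesis
      using Krein_Milman_Minkowski[OF comp conv] by simp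
  qed
  have WP: "W \<subseteq> P"
    by (auto simp: W_def extreme_point_of_def)
  have "V \<notin> convex hull W"
  proof
    assume VW: "V \<in> convex hull W"
    have "convex hull W \<subseteq> P"
      using WP conv by (rule hull_minimal)
    then have "V extreme_point_of (convex hull W)"
      using V VW by (auto simp: extreme_point_of_def)
    then show False
      using extreme_point_of_convex_hull by (fastforce simp: W_def)
  qed
  then obtain c \<beta> where c: "c \<bullet> V < \<beta>" "\<And>x. x \<in> convex hull W \<Longrightarrow> c \<bullet> x > \<beta>"
    using separating_hyperplane_closed_point[of "convex hull W" V] fin
    by (auto simp: finite_imp_compact_convex_hull compact_imp_closed)
  have cW: "c \<bullet> (w - V) > 0" if "w \<in> W" for w
    using c(1) c(2)[of w] that by (simp add: inner_diff_right hull_inc)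
  \<comment> \<open>Central projection from \<open>V\<close> to the plane
    \<open>c \<bullet> (x - V) = 1\<close>; it is defined since \<open>c\<close> separates
    \<open>V\<close> from the other vertices.\<close>
  define r where "r w = V + (1 / (c \<bullet> (w - V))) *\<^sub>R (w - V)" for w
  have r: "w = V + (c \<bullet> (w - V)) *\<^sub>R (r w - V)" if "w \<in> W" for w
    using cW[OF that] by (simp add: r_def)
  define Q where "Q = convex hull (r ` W)"
  have convQ: "convex Q"
    by (simp add: Q_def)
  have cQ: "c \<bullet> (q - V) = 1" if "q \<in> Q" for q
  proof -
    have "Q \<subseteq> {x. c \<bullet> x = 1 + c \<bullet> V}"
      unfolding Q_def
    proof (intro hull_minimal convex_hyperplane)
      show "r ` W \<subseteq> {x. c \<bullet> x = 1 + c \<bullet> V}"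
        using cW by (force simp: r_def inner_add_right)
    qed
    then show ?thesis
      using that by (auto simp: inner_diff_right)
  qed
  have Wne: "W \<noteq> {}"
  proof
    assume "W = {}"
    then have "P = {V}"
      using hullP by simp
    then show False
      using P(2) by simp
  qed
  have cone: "\<exists>s\<ge>0. \<exists>q\<in>Q. p = V + s *\<^sub>R (q - V)" if "p \<in> P" for p
  proof -
    define T where "T = {V + s *\<^sub>R (q - V) |s q. 0 \<le> s \<and> q \<in> Q}"
    have "convex T"
    proof (rule convexI)
      fix x y u v assume x: "x \<in> T" and y: "y \<in> T" and uv: "0 \<le> u" "0 \<le> v" "u + v = (1::real)"
      obtain s1 q1 where 1: "x = V + s1 *\<^sub>R (q1 - V)" "0 \<le> s1" "q1 \<in> Q"
        using x by (auto simp: T_def)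
      obtain s2 q2 where 2: "y = V + s2 *\<^sub>R (q2 - V)" "0 \<le> s2" "q2 \<in> Q"
        using y by (auto simp: T_def)
      obtain q where q: "q \<in> Q"
        "(u * s1) *\<^sub>R (q1 - V) + (v * s2) *\<^sub>R (q2 - V) = (u * s1 + v * s2) *\<^sub>R (q - V)"
        using convex_ray_add[OF convQ 1(3) 2(3), of "u * s1" "v * s2" V] 1 2 uv by auto
      have "u *\<^sub>R x + v *\<^sub>R y = (u + v) *\<^sub>R V + ((u * s1) *\<^sub>R (q1 - V) + (v * s2) *\<^sub>R (q2 - V))"
        unfolding 1(1) 2(1) by (simp add: algebra_simps)
      then have "u *\<^sub>R x + v *\<^sub>R y = V + (u * s1 + v * s2) *\<^sub>R (q - V)"
        using q uv by simp
      then show "u *\<^sub>R x + v *\<^sub>R y \<in> T"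
        unfolding T_def using q(1) uv 1 2
        by (intro CollectI exI[of _ "u * s1 + v * s2"] exI[of _ q]) auto
    qed
    moreover have "insert V W \<subseteq> T"
    proof
      fix w assume "w \<in> insert V W"
      then consider "w = V" | "w \<in> W"
        by blast
      then show "w \<in> T"
      proof cases
        case 1
        obtain w' where "w' \<in> W"
          using Wne by blast
        then have "r w' \<in> Q"
          by (simp add: Q_def hull_inc)
        then show ?thesis
          unfolding T_def 1 by (intro CollectI exI[of _ 0] exI[of _ "r w'"]) auto
      next
        case 2
        then have "r w \<in> Q"
          by (simp add: Q_def hull_inc)
        then show ?thesis
          unfolding T_def using r[OF 2] cW[OF 2]
          by (intro CollectI exI[of _ "c \<bullet> (w - V)"] exI[of _ "r w"]) auto
      qed
    qed
    ultimately have "P \<subseteq> T"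
      unfolding hullP by (intro hull_minimal)
    then show ?thesis
      using that unfolding T_def by blast
  qed

  define X where "X = {q. q extreme_point_of Q}"
  have XW: "X \<subseteq> r ` W"
    unfolding X_def Q_def using extreme_point_of_convex_hull by blast
  have hullQ: "Q = convex hull X"
    unfolding X_def using Krein_Milman_Minkowski[of Q] fin
    by (simp add: Q_def finite_imp_compact_convex_hull)
  have finX: "finite X"
    using XW fin finite_surj by blast
  have pick: "\<exists>s w. s > 0 \<and> w \<in> P \<and> w = V + s *\<^sub>R (q - V)" if q: "q \<in> X" for q
  proof -
    obtain w where w: "w \<in> W" "q = r w"
      using q XW by blast
    show ?thesis
      using r[OF w(1)] cW[OF w(1)] WP w by (intro exI[of _ "c \<bullet> (w - V)"] exI[of _ w]) auto
  qed
  define edge where "edge q = P \<inter> {V + s *\<^sub>R (q - V) |s. 0 \<le> s}" for q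
  have edge: "edge q edge_of P" "V \<in> edge q" if q: "q \<in> X" for q
  proof -
    obtain s w where "s > 0" "w \<in> P" "w = V + s *\<^sub>R (q - V)"
      using pick[OF q] by blast
    then show "edge q edge_of P"
      using edge_of_vertex_figure[OF conv VP convQ cQ cone] q by (auto simp: X_def edge_def)
    show "V \<in> edge q"
      using VP by (auto simp: edge_def intro!: exI[of _ "0::real"])
  qed
  have XQ: "X \<subseteq> Q"
    by (auto simp: X_def extreme_point_of_def)
  have "inj_on edge X"
  proof (rule inj_onI)
    fix q q' assume q: "q \<in> X" and q': "q' \<in> X" and eq: "edge q = edge q'"
    obtain s w where w: "s > 0" "w \<in> P" "w = V + s *\<^sub>R (q - V)"
      using pick[OF q] by blast
    then have "w \<in> edge q'"
      unfolding eq[symmetric] by (auto simp: edge_def intro!: exI[of _ s])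
    then obtain s' where "w = V + s' *\<^sub>R (q' - V)"
      by (auto simp: edge_def)
    then have *: "s *\<^sub>R (q - V) = s' *\<^sub>R (q' - V)"
      using w by simp
    have "c \<bullet> (q - V) = 1" "c \<bullet> (q' - V) = 1"
      using q q' XQ cQ by auto
    then have "s = s'"
      using arg_cong[OF *, of "(\<bullet>) c"] by simp
    then show "q = q'"
      using * w(1) by simp
  qed
  moreover have "finite {E. E edge_of P \<and> V \<in> E}"
    using edges3 by (simp add: card_ge_0_finite)
  ultimately have X3: "card X \<le> 3"
    using edge edges3 card_inj_on_le[of edge X "{E. E edge_of P \<and> V \<in> E}"] by auto
  define D where "D = (\<lambda>q. q - V) ` X"
  have "span D = UNIV"
  proof (rule ccontr)
    assume "span D \<noteq> UNIV"
    then have low: "dim D < DIM(real^3)"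
      using dim_eq_full[of D] dim_subset_UNIV[of D] by simp
    have sub: "(\<lambda>p. p - V) ` P \<subseteq> span D"
    proof clarify
      fix p assume "p \<in> P"
      then obtain s q where q: "q \<in> Q" "p = V + s *\<^sub>R (q - V)"
        using cone by blast
      have "Q \<subseteq> (\<lambda>x. V + x) ` span D"
        unfolding hullQ
      proof (rule hull_minimal)
        show "X \<subseteq> (\<lambda>x. V + x) ` span D"
          by (force simp: D_def image_iff intro: span_base bexI[of _ "x - V" for x])
        show "convex ((\<lambda>x. V + x) ` span D)"
          by (simp add: convex_translation subspace_imp_convex)
      qed
      then obtain d where "d \<in> span D" "q = V + d"
        using q(1) by blast
      then show "p - V \<in> span D"
        using q(2) by (simp add: span_scale)
    qed
    have "dim ((\<lambda>p. p - V) ` P) < DIM(real^3)"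
      using dim_subset[OF sub] low by simp
    then have "interior ((\<lambda>p. p - V) ` P) = {}"
      by (rule empty_interior_lowdim)
    then have "interior ((\<lambda>p. - V + p) ` P) = {}"
      by simp
    then show False
      using P(2) by (simp only: interior_translation image_is_empty)
  qed
  then have dimD: "dim D = 3"
    using dim_eq_full[of D] by simp
  have cardX: "card X = 3"
  proof -
    have "dim D \<le> card D"
      using finX by (intro dim_le_card') (simp add: D_def)
    also have "\<dots> \<le> card X"
      unfolding D_def using finX by (rule card_image_le)
    finally show ?thesis
      using X3 dimD by simp
  qed
  then obtain f where f: "bij_betw f (UNIV :: 3 set) X"
    using finite_same_card_bij[of "UNIV :: 3 set" X] finX by auto
  have "\<exists>s w. s > 0 \<and> w \<in> P \<and> w = V + s *\<^sub>R (f i - V)" for i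
    using pick f by (auto simp: bij_betw_def)
  then obtain s where s: "\<And>i. s i > 0" "\<And>i. V + s i *\<^sub>R (f i - V) \<in> P"
    by metis
  define e where "e i = s i *\<^sub>R (f i - V)" for i
  have spane: "span (range e) = UNIV"
  proof -
    have "D \<subseteq> span (range e)"
    proof
      fix x assume "x \<in> D"
      then obtain i where "x = f i - V"
        using f by (auto simp: D_def bij_betw_def)
      then have "x = (1 / s i) *\<^sub>R e i"
        using s(1)[of i] by (simp add: e_def)
      then show "x \<in> span (range e)"
        by (simp add: span_base span_scale)
    qed
    then show ?thesis
      using \<open>span D = UNIV\<close> span_minimal[of D "span (range e)"] by auto
  qed
  have cards: "card (range e) \<le> 3"
    using card_image_le[of "UNIV :: 3 set" e] by simp
  have dime: "dim (range e) = 3"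
    using spane dim_eq_full[of "range e"] by simp
  have inde: "independent (range e)"
    using cards dime by (intro card_le_dim_spanning[of _ UNIV]) (simp_all add: spane)
  then have "card (range e) = 3"
    using dime dim_eq_card_independent by metis
  then have inje: "inj e"
    by (simp add: eq_card_imp_inj_on)
  define d where "d i = dual_vec (range e) (e i)" for i
  have d: "d i \<bullet> e j = (if i = j then 1 else 0)" for i j
    using dual_vec(2)[OF inde, of "e i" "e j"] injD[OF inje, of j i] by (auto simp: d_def)
  have d0: "norm (d i) > 0" for i
    using d[of i i] by auto
  \<comment> \<open>The dual vectors are nonnegative on \<open>P\<close> translated by
    \<open>- V\<close>; the minus sign turns them into outer normals.\<close>
  define a where "a i = (- 1 / norm (d i)) *\<^sub>R d i" for i
  have "vertex_frame P V a e"
    unfolding vertex_frame_def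
  proof (intro conjI allI ballI)
    show "biorthogonal a e"
      using d d0 by (auto simp: biorthogonal_def a_def)
    fix i
    show "a i \<bullet> e i < 0" "norm (a i) = 1"
      using d[of i i] d0[of i] by (auto simp: a_def)
    show "V + e i \<in> P"
      using s by (simp add: e_def)
    fix p assume "p \<in> P"
    then obtain t q where q: "t \<ge> 0" "q \<in> Q" "p = V + t *\<^sub>R (q - V)"
      using cone by blast
    have "Q \<subseteq> {x. d i \<bullet> x \<ge> d i \<bullet> V}"
      unfolding hullQ
    proof (intro hull_minimal convex_halfspace_ge)
      show "X \<subseteq> {x. d i \<bullet> x \<ge> d i \<bullet> V}"
      proof
        fix x assume "x \<in> X"
        then obtain j where j: "x = f j"
          using f by (auto simp: bij_betw_def)
        have "s j * (d i \<bullet> (x - V)) \<ge> 0"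
          using d[of i j] by (simp add: e_def j)
        then show "x \<in> {x. d i \<bullet> x \<ge> d i \<bullet> V}"
          using s(1)[of j] by (simp add: zero_le_mult_iff inner_diff_right)
      qed
    qed
    then have "d i \<bullet> (p - V) \<ge> 0"
      using q by (auto simp: inner_diff_right)
    then show "a i \<bullet> (p - V) \<le> 0"
      using d0[of i] by (simp add: a_def)
  qed (rule VP)
  then show ?thesis
    by blast
qed

section \<open>Nice vertices\<close>

text \<open>The maximizers form a compact face, and an extreme point of a face is one of
  \<open>P\<close>.\<close>

lemma exists_extreme_point_maximizing:
  fixes P :: "'a::euclidean_space set"
  assumes "compact P" "convex P" "P \<noteq> {}"
  shows "\<exists>V. V extreme_point_of P \<and> (\<forall>p\<in>P. c \<bullet> p \<le> c \<bullet> V)"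
proof -
  have "continuous_on P (\<lambda>p. c \<bullet> p)"
    by (intro continuous_intros)
  from continuous_attains_sup[OF assms(1,3) this]
  obtain m where m: "m \<in> P" "\<And>p. p \<in> P \<Longrightarrow> c \<bullet> p \<le> c \<bullet> m"
    by blast
  define F where "F = P \<inter> {x. c \<bullet> x = c \<bullet> m}"
  have "F face_of P"
    unfolding F_def using assms(2) m(2) by (rule face_of_Int_supporting_hyperplane_le)
  moreover have "compact F" "convex F" "F \<noteq> {}"
    using assms m(1) compact_Int_closed[OF _ closed_hyperplane] convex_Int[OF _ convex_hyperplane]
    unfolding F_def by blast+
  then obtain V where V: "V extreme_point_of F"
    using extreme_point_exists_convex by blast
  ultimately have "V extreme_point_of P"
    using extreme_point_of_face by blast
  moreover have "c \<bullet> V = c \<bullet> m"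
    using V by (simp add: F_def extreme_point_of_def)
  ultimately show ?thesis
    using m(2) by auto
qed

lemma farthest_point_extreme:
  fixes P :: "'a::euclidean_space set"
  assumes "U \<in> P" "\<And>p. p \<in> P \<Longrightarrow> dist V p \<le> dist V U"
  shows "U extreme_point_of P"
  unfolding extreme_point_of_def
proof (intro conjI ballI notI)
  fix x y assume "x \<in> P" "y \<in> P" "U \<in> open_segment x y"
  then show False
    using assms(2) dist_decreases_open_segment[of U x y V] by (metis dist_commute not_le)
qed (rule assms(1))

lemma vertex_frameD:
  assumes "vertex_frame P V a e"
  shows "biorthogonal a e" "V \<in> P" "a i \<bullet> e i < 0" "norm (a i) = 1" "V + e i \<in> P"
    "p \<in> P \<Longrightarrow> a i \<bullet> (p - V) \<le> 0"
  using assms by (auto simp: vertex_frame_def)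

text \<open>Expanding \<open>x\<close> in the \<open>a i\<close> gives nonnegative coefficients, so
  \<open>x \<bullet> (z - V)\<close> is a sum of nonpositive terms. If the sum is 0, then every term
  is.\<close>

lemma normal_nonneg_combination:
  assumes fr: "vertex_frame P V a e" and x: "\<And>i. x \<bullet> e i \<le> 0" and z: "\<And>i. a i \<bullet> (z - V) \<le> 0"
  shows "x \<bullet> (z - V) \<le> 0" "x \<bullet> e i \<noteq> 0 \<Longrightarrow> x \<bullet> (z - V) = 0 \<Longrightarrow> a i \<bullet> (z - V) = 0"
proof -
  note D = vertex_frameD[OF fr]
  define l where "l i = ((x \<bullet> e i) / (a i \<bullet> e i)) * (a i \<bullet> (z - V))" for i
  have "x \<bullet> (z - V) = (\<Sum>i\<in>UNIV. ((x \<bullet> e i) / (a i \<bullet> e i)) *\<^sub>R a i) \<bullet> (z - V)"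
    using biorthogonal_expansion[OF D(1), of x] by simp
  then have eq: "x \<bullet> (z - V) = (\<Sum>i\<in>UNIV. l i)"
    by (simp add: inner_sum_left l_def)
  have le: "l i \<le> 0" for i
    unfolding l_def using D(3)[of i] x[of i] z[of i]
    by (intro mult_nonneg_nonpos divide_nonpos_neg)
  show "x \<bullet> (z - V) \<le> 0"
    unfolding eq using le by (rule sum_nonpos)
  assume i: "x \<bullet> e i \<noteq> 0" and 0: "x \<bullet> (z - V) = 0"
  have "(\<Sum>i\<in>UNIV. - l i) = 0"
    using 0 eq by (simp add: sum_negf)
  then have "l i = 0"
    using le by (subst (asm) sum_nonneg_eq_0_iff) auto
  then show "a i \<bullet> (z - V) = 0"
    using i D(3)[of i] by (auto simp: l_def)
qed

lemma outer_normal_cone_eq: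
  assumes fr: "vertex_frame P V a e"
  shows "outer_normal_cone P V = {x. \<forall>i. x \<bullet> e i \<le> 0}"
proof (intro subset_antisym subsetI)
  fix x assume "x \<in> outer_normal_cone P V"
  then have "(V + e i - V) \<bullet> x \<le> 0" for i
    using vertex_frameD(5)[OF fr] unfolding outer_normal_cone_def by blast
  then show "x \<in> {x. \<forall>i. x \<bullet> e i \<le> 0}"
    by (simp add: inner_commute)
next
  fix x assume "x \<in> {x. \<forall>i. x \<bullet> e i \<le> 0}"
  then show "x \<in> outer_normal_cone P V"
    using normal_nonneg_combination(1)[OF fr] vertex_frameD(6)[OF fr]
    by (simp add: outer_normal_cone_def inner_commute)
qed

text \<open>A facet normal of \<open>W\<close> whose supporting plane passes through \<open>V\<close> is a facet normal of \<open>V\<close>: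
  any facet normal \<open>a i\<close> of \<open>V\<close> occurring in it vanishes on the facet.\<close>

lemma facet_normal_at_vertex:
  assumes V: "vertex_frame P V a e" and W: "vertex_frame P W a' e'"
    and eq: "a' k \<bullet> V = a' k \<bullet> W"
  shows "a' k \<in> range a"
proof -
  note DV = vertex_frameD[OF V] and DW = vertex_frameD[OF W]
  define n where "n = a' k"
  have le: "n \<bullet> p \<le> n \<bullet> V" if "p \<in> P" for p
    using DW(6)[OF that, of k] eq by (simp add: n_def inner_diff_right)
  have ne: "n \<bullet> e i \<le> 0" for i
    using le[OF DV(5)[of i]] by (simp add: inner_add_right)
  have "n \<noteq> 0"
    using DW(4)[of k] by (auto simp: n_def)
  then obtain i where i: "n \<bullet> e i \<noteq> 0"
    using biorthogonal_eq_0[OF biorthogonal_sym[OF DV(1)], of n] by (auto simp: inner_commute)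
  have on_facet: "a i \<bullet> (p - V) = 0" if "p \<in> P" "n \<bullet> p = n \<bullet> W" for p
    using normal_nonneg_combination(2)[OF V ne DV(6)[OF that(1)] i] that(2) eq
    by (simp add: inner_diff_right n_def)
  have 0: "a i \<bullet> e' l = 0" if "l \<noteq> k" for l
  proof -
    have "n \<bullet> e' l = 0"
      using DW(1) that by (auto simp: n_def biorthogonal_def)
    then have "a i \<bullet> (W + e' l - V) = 0"
      using DW(5)[of l] by (intro on_facet) (auto simp: inner_add_right)
    moreover have "a i \<bullet> (W - V) = 0"
      using DW(2) by (intro on_facet) auto
    ultimately show ?thesis
      by (simp add: inner_diff_right inner_add_right)
  qed
  define c where "c = (a i \<bullet> e' k) / (n \<bullet> e' k)"
  have nk: "n \<bullet> e' k \<noteq> 0"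
    using DW(3)[of k] by (simp add: n_def)
  have "e' l \<bullet> (a i - c *\<^sub>R n) = 0" for l
  proof (cases "l = k")
    case True
    then show ?thesis
      using nk by (simp add: inner_diff_right c_def inner_commute)
  next
    case False
    then have "n \<bullet> e' l = 0"
      using DW(1) by (auto simp: n_def biorthogonal_def)
    then show ?thesis
      using 0[OF False] by (simp add: inner_diff_right inner_commute)
  qed
  then have ai: "a i = c *\<^sub>R n"
    using biorthogonal_eq_0[OF biorthogonal_sym[OF DW(1)], of "a i - c *\<^sub>R n"] by simp
  have "c * (n \<bullet> e i) < 0"
    using DV(3)[of i] by (simp add: ai)
  then have "c > 0"
    using ne[of i] by (auto simp: mult_less_0_iff)
  moreover have "\<bar>c\<bar> * norm n = 1"
    using DV(4)[of i] by (simp add: ai)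
  ultimately have "c = 1"
    using DW(4)[of k] by (simp add: n_def)
  then show ?thesis
    using ai n_def by (metis rangeI scaleR_one)
qed

text \<open>The normals of all vertex frames describe \<open>P\<close>: a functional separating
  \<open>z\<close> from \<open>P\<close> is extremal at a vertex \<open>V\<close> and is a
  nonnegative combination of the normals there, so one of these is violated by \<open>z\<close>. For
  independence at a feasible \<open>z\<close>, maximize the sum of the normals tight at
  \<open>z\<close>: all of them are tight at the maximizing vertex, where the tight normals form a
  basis.\<close>

lemma simple_polytope_halfspaces:
  assumes P: "polytope P" "P \<noteq> {}"
    and fr: "\<And>V. V extreme_point_of P \<Longrightarrow> vertex_frame P V (fa V) (fe V)"
  shows "\<exists>N b. simple_halfspaces3 N b \<and> simple_halfspaces.poly N b = P \<and>
    (\<forall>V. V extreme_point_of P \<longrightarrow> simple_halfspaces.tight N b V = range (fa V)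
       \<and> (\<forall>i. b (fa V i) = fa V i \<bullet> V))"
proof -
  have conv: "convex P" and comp: "compact P"
    using P by (auto intro: polytope_imp_convex polytope_imp_compact)
  define Ex where "Ex = {V. V extreme_point_of P}"
  define N where "N = (\<Union>V\<in>Ex. range (fa V))"
  \<comment> \<open>The support function of \<open>P\<close>, so that a normal shared by several
    vertices gets a consistent right-hand side.\<close>
  define b where "b n = (SUP p\<in>P. n \<bullet> p)" for n
  have fin: "finite N"
    using P(1) by (simp add: N_def Ex_def finite_polyhedron_extreme_points polytope_imp_polyhedron)
  have b: "b (fa V i) = fa V i \<bullet> V" if "V \<in> Ex" for V i
    unfolding b_def
  proof (rule cSup_eq_maximum)
    show "fa V i \<bullet> V \<in> (\<bullet>) (fa V i) ` P"
      using fr[of V] that vertex_frameD(2) by (auto simp: Ex_def)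
    show "x \<le> fa V i \<bullet> V" if "x \<in> (\<bullet>) (fa V i) ` P" for x
      using vertex_frameD(6)[OF fr[of V]] that \<open>V \<in> Ex\<close> by (auto simp: Ex_def inner_diff_right)
  qed
  have le: "n \<bullet> p \<le> b n" if n: "n \<in> N" and p: "p \<in> P" for n p
  proof -
    obtain V i where V: "V \<in> Ex" "n = fa V i"
      using n by (auto simp: N_def)
    then have "fa V i \<bullet> (p - V) \<le> 0"
      using vertex_frameD(6)[OF fr p] by (simp add: Ex_def)
    then show ?thesis
      using b[OF V(1)] V(2) by (simp add: inner_diff_right)
  qed
  have tight: "{n \<in> N. n \<bullet> V = b n} = range (fa V)" if V: "V \<in> Ex" for V
  proof (intro subset_antisym subsetI)
    fix n assume "n \<in> {n \<in> N. n \<bullet> V = b n}"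
    then obtain W k where W: "W \<in> Ex" "n = fa W k" "fa W k \<bullet> V = b (fa W k)"
      by (auto simp: N_def)
    then show "n \<in> range (fa V)"
      using facet_normal_at_vertex[OF fr[of V] fr[of W], of k] V b by (simp add: Ex_def)
  next
    fix n assume "n \<in> range (fa V)"
    then show "n \<in> {n \<in> N. n \<bullet> V = b n}"
      using V b by (auto simp: N_def)
  qed
  have poly: "z \<in> P" if z: "\<And>n. n \<in> N \<Longrightarrow> n \<bullet> z \<le> b n" for z
  proof (rule ccontr)
    assume "z \<notin> P"
    then obtain c \<beta> where c: "c \<bullet> z < \<beta>" "\<And>x. x \<in> P \<Longrightarrow> c \<bullet> x > \<beta>"
      using separating_hyperplane_closed_point[of P z] conv comp compact_imp_closed by blast
    obtain V where V: "V extreme_point_of P" "\<And>p. p \<in> P \<Longrightarrow> (- c) \<bullet> p \<le> (- c) \<bullet> V"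
      using exists_extreme_point_maximizing[OF comp conv P(2), of "- c"] by blast
    note D = vertex_frameD[OF fr[OF V(1)]]
    have "(- c) \<bullet> fe V i \<le> 0" for i
      using V(2)[OF D(5)[of i]] by (simp add: inner_add_right)
    moreover have "fa V i \<bullet> (z - V) \<le> 0" for i
      using z[of "fa V i"] b[of V i] V(1) by (auto simp: N_def Ex_def inner_diff_right)
    ultimately have "(- c) \<bullet> (z - V) \<le> 0"
      using normal_nonneg_combination(1)[OF fr[OF V(1)]] by blast
    then show False
      using c(1) c(2)[OF D(2)] by (simp add: inner_diff_right)
  qed
  have simple: "independent {n \<in> N. n \<bullet> z = b n}" if z: "\<And>n. n \<in> N \<Longrightarrow> n \<bullet> z \<le> b n" for z
  proof -
    define T where "T = {n \<in> N. n \<bullet> z = b n}"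
    have finT: "finite T"
      using fin by (simp add: T_def)
    obtain V where V: "V extreme_point_of P" "(\<Sum>n\<in>T. n) \<bullet> z \<le> (\<Sum>n\<in>T. n) \<bullet> V"
      using exists_extreme_point_maximizing[OF comp conv P(2), of "\<Sum>n\<in>T. n"] poly[OF z] by blast
    have VP: "V \<in> P"
      using V(1) by (simp add: extreme_point_of_def)
    have "(\<Sum>n\<in>T. b n - n \<bullet> V) \<le> 0"
    proof -
      have "(\<Sum>n\<in>T. n \<bullet> z) = (\<Sum>n\<in>T. b n)"
        by (intro sum.cong) (auto simp: T_def)
      then show ?thesis
        using V(2) by (simp add: inner_sum_left sum_subtractf)
    qed
    moreover have nonneg: "\<And>n. n \<in> T \<Longrightarrow> 0 \<le> b n - n \<bullet> V"
      using le[OF _ VP] by (auto simp: T_def)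
    ultimately have "(\<Sum>n\<in>T. b n - n \<bullet> V) = 0"
      by (intro antisym sum_nonneg)
    then have "T \<subseteq> {n \<in> N. n \<bullet> V = b n}"
      using sum_nonneg_eq_0_iff[OF finT nonneg] by (auto simp: T_def)
    also have "\<dots> = range (fa V)"
      using V(1) by (intro tight) (simp add: Ex_def)
    finally show ?thesis
      using biorthogonal_basis(2)[OF vertex_frameD(1)[OF fr[OF V(1)]]] independent_mono
      unfolding T_def by blast
  qed
  have sh: "simple_halfspaces N b"
    by (rule simple_halfspaces.intro[OF fin]) (rule simple)
  then have sh3: "simple_halfspaces3 N b"
    by (simp add: simple_halfspaces3_def)
  have "simple_halfspaces.poly N b = P"
    using le poly by (auto simp: simple_halfspaces.poly_def[OF sh])
  with sh3 show ?thesis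
    using tight b by (intro exI[of _ N] exI[of _ b]) (auto simp: simple_halfspaces.tight_def[OF sh] Ex_def)
qed

text \<open>Openness allows a nice direction to be replaced by one that is also generic.\<close>

lemma open_nice_dir: "open {X. nice_dir a e X}"
proof -
  have "{X. nice_dir a e X} = (\<Inter>i\<in>UNIV. {X. X \<bullet> e i < 0} \<inter> {X. 0 < X \<bullet> a i} \<inter>
      (\<Inter>j\<in>- {i}. {X. (a i \<bullet> a j) * (X \<bullet> a i) < X \<bullet> a j}))"
    unfolding nice_dir_def by auto
  also have "open \<dots>"
    by (intro open_INT open_Int ballI open_Collect_less continuous_intros) auto
  finally show ?thesis .
qed

text \<open>\<open>p - V\<close> is a nonnegative combination of the edge vectors, and
  \<open>- (X \<bullet> e i)\<close> is at least \<open>c * norm (e i)\<close> for each of them; the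
  triangle inequality compares the sums.\<close>

lemma nice_dir_pointed:
  assumes fr: "vertex_frame P V a e" and X: "nice_dir a e X"
  shows "\<exists>c>0. \<forall>p\<in>P. c * norm (V - p) \<le> X \<bullet> (V - p)"
proof -
  note D = vertex_frameD[OF fr]
  have e0: "norm (e i) > 0" for i
    using D(3)[of i] by auto
  define c where "c = Min (range (\<lambda>i. - (X \<bullet> e i) / norm (e i)))"
  have "0 < - (X \<bullet> e i) / norm (e i)" for i
    using X e0[of i] by (intro divide_pos_pos) (auto simp: nice_dir_def)
  then have "c > 0"
    unfolding c_def by (subst Min_gr_iff) auto
  moreover have "c * norm (V - p) \<le> X \<bullet> (V - p)" if p: "p \<in> P" for p
  proof -
    define l where "l i = ((p - V) \<bullet> a i) / (e i \<bullet> a i)" for i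
    have l: "l i \<ge> 0" for i
      unfolding l_def using D(6)[OF p, of i] D(3)[of i]
      by (intro divide_nonpos_neg) (auto simp: inner_commute)
    have "p - V = (\<Sum>i\<in>UNIV. l i *\<^sub>R e i)"
      unfolding l_def by (rule biorthogonal_expansion[OF biorthogonal_sym[OF D(1)]])
    then have pV: "V - p = (\<Sum>i\<in>UNIV. - (l i *\<^sub>R e i))"
      unfolding sum_negf by (simp add: algebra_simps)
    have "c * norm (V - p) \<le> c * (\<Sum>i\<in>UNIV. l i * norm (e i))"
    proof (rule mult_left_mono)
      show "norm (V - p) \<le> (\<Sum>i\<in>UNIV. l i * norm (e i))"
        unfolding pV using l by (intro order_trans[OF norm_sum] sum_mono) auto
    qed (use \<open>c > 0\<close> in simp)
    also have "\<dots> = (\<Sum>i\<in>UNIV. l i * (c * norm (e i)))"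
      by (simp add: sum_distrib_left mult_ac)
    also have "\<dots> \<le> (\<Sum>i\<in>UNIV. l i * - (X \<bullet> e i))"
    proof (intro sum_mono mult_left_mono l)
      fix i
      have "c \<le> - (X \<bullet> e i) / norm (e i)"
        unfolding c_def by (intro Min_le) auto
      then show "c * norm (e i) \<le> - (X \<bullet> e i)"
        using pos_le_divide_eq[OF e0[of i]] by blast
    qed
    also have "\<dots> = X \<bullet> (V - p)"
      unfolding pV by (simp add: inner_sum_right)
    finally show ?thesis .
  qed
  ultimately show ?thesis
    by blast
qed

lemma (in simple_halfspaces3) nice_dir_imp_ten_normals:
  assumes comp: "compact poly"
    and fr: "\<And>V. V extreme_point_of poly \<Longrightarrow> vertex_frame poly V (fa V) (fe V)"
    and tb: "\<And>V. V extreme_point_of poly \<Longrightarrow> tight V = range (fa V)"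
      "\<And>V i. V extreme_point_of poly \<Longrightarrow> b (fa V i) = fa V i \<bullet> V"
    and V: "V extreme_point_of poly" and X0: "nice_dir (fa V) (fe V) X0"
  shows "10 \<le> max_normals poly"
proof -
  have VP: "V \<in> poly"
    using V by (simp add: extreme_point_of_def)
  note DV = vertex_frameD[OF fr[OF V]]
  obtain X where X: "nice_dir (fa V) (fe V) X" and generic: "generic_dir V X"
    using exists_generic_dir[OF open_nice_dir, of "fa V" "fe V" V] X0 by blast
  obtain c where c: "c > 0" "\<And>p. p \<in> poly \<Longrightarrow> c * norm (V - p) \<le> X \<bullet> (V - p)"
    using nice_dir_pointed[OF fr[OF V] X] by blast
  have cont: "continuous_on poly (\<lambda>p. dist V p)"
    by (intro continuous_intros)
  obtain U where U: "U \<in> poly" "\<And>p. p \<in> poly \<Longrightarrow> dist V p \<le> dist V U"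
    using continuous_attains_sup[OF comp _ cont] VP by blast
  have UE: "U extreme_point_of poly"
    using U by (rule farthest_point_extreme)
  note DU = vertex_frameD[OF fr[OF UE]]
  have UV: "U \<noteq> V"
  proof
    assume "U = V"
    then have "V + fe V 1 = V"
      using U(2)[OF DV(5)[of 1]] by simp
    then show False
      using DV(3)[of 1] by simp
  qed
  \<comment> \<open>Since \<open>U\<close> is farthest from \<open>V\<close>, a step along an edge
    at \<open>U\<close> does not increase the distance. Expanding the square gives
    \<open>(U - V) \<bullet> fe U i < 0\<close>, which is positivity of the multipliers of the
    normals at \<open>U\<close>.\<close>
  have strictU: "tight U \<in> strict V"
  proof -
    define l where "l n = (let i = inv (fa U) n in ((U - V) \<bullet> fe U i) / (n \<bullet> fe U i))" for n
    have inj: "inj (fa U)" and ind: "independent (tight U)"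
      using biorthogonal_basis[OF DU(1)] tb(1)[OF UE] by simp_all
    have "U - V = (\<Sum>i\<in>UNIV. (((U - V) \<bullet> fe U i) / (fa U i \<bullet> fe U i)) *\<^sub>R fa U i)"
      by (rule biorthogonal_expansion[OF DU(1)])
    also have "\<dots> = (\<Sum>n\<in>tight U. l n *\<^sub>R n)"
      using inj by (simp add: tb(1)[OF UE] sum.reindex l_def)
    finally have eq: "U - V = (\<Sum>n\<in>tight U. l n *\<^sub>R n)" .
    have tight: "n \<bullet> U = b n" if "n \<in> tight U" for n
      using that by (simp add: tight_def)
    note u = foot_unique[OF ind eq tight]
    have "0 < cvar b (tight U) n V" if n: "n \<in> N" for n
    proof (cases "n \<in> tight U")
      case True
      then obtain i where i: "n = fa U i"
        by (auto simp: tb(1)[OF UE])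
      have "norm (V - (U + fe U i)) \<le> norm (V - U)"
        using U(2)[OF DU(5)[of i]] by (simp add: dist_norm)
      then have "(norm ((U - V) + fe U i))\<^sup>2 \<le> (norm (U - V))\<^sup>2"
        by (simp add: norm_minus_commute algebra_simps)
      then have "2 * ((U - V) \<bullet> fe U i) + fe U i \<bullet> fe U i \<le> 0"
        unfolding power2_norm_eq_inner by (simp add: inner_add_left inner_add_right inner_commute)
      moreover have "fe U i \<bullet> fe U i > 0"
        using DU(3)[of i] by auto
      ultimately have "(U - V) \<bullet> fe U i < 0"
        by linarith
      then have "l n > 0"
        using DU(3)[of i] inj by (simp add: l_def i divide_neg_neg)
      then show ?thesis
        using u(2)[OF _ True] by simp
    next
      case False
      moreover have "n \<bullet> U \<le> b n"
        using U(1) n by (simp add: poly_def)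
      ultimately have "n \<bullet> U < b n"
        using n by (auto simp: tight_def)
      then show ?thesis
        using u(1) False by (simp add: cvar_def)
    qed
    then show ?thesis
      using ind by (simp add: strict_def) (simp add: tight_def)
  qed
  have "\<exists>y. {} \<in> strict y \<and> 2 ^ card (tight V) + 3 \<le> card (strict y)"
  proof (rule exists_many_strict[where X = X and c = c and U = U])
    show "bounded poly"
      using comp by (rule compact_imp_bounded)
    show "independent (tight V)" "span (tight V) = UNIV" "tight V \<noteq> {}"
      using biorthogonal_basis[OF DV(1)] by (simp_all add: tb(1)[OF V])
    show "span (tight U) = UNIV"
      using biorthogonal_basis[OF DU(1)] by (simp add: tb(1)[OF UE])
    show "\<not> (\<exists>n. tight U \<subseteq> {n})"
    proof
      assume "\<exists>n. tight U \<subseteq> {n}"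
      then obtain n where "tight U \<subseteq> {n}"
        by blast
      then have "card (tight U) \<le> card {n}"
        by (intro card_mono) auto
      then show False
        using biorthogonal_basis(4)[OF DU(1)] by (simp add: tb(1)[OF UE])
    qed
    show "0 < cvar b S n (V - X)" if S: "S \<subseteq> tight V" and n: "n \<in> tight V" for S n
    proof -
      obtain I where "S = fa V ` I"
        using S unfolding tb(1)[OF V] subset_image_iff by blast
      moreover obtain m where "n = fa V m"
        using n unfolding tb(1)[OF V] by blast
      ultimately show ?thesis
        using cvar_nice_dir_pos[OF DV(1,3,4) tb(2)[OF V] X] by simp
    qed
  qed (use generic c U UV strictU VP in auto)
  then obtain y where y: "{} \<in> strict y" "2 ^ card (tight V) + 3 \<le> card (strict y)"
    by blast
  have "card (tight V) = 3"
    using biorthogonal_basis(4)[OF DV(1)] by (simp add: tb(1)[OF V])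
  \<comment> \<open>There are at least \<open>2 ^ 3 + 3 = 11\<close> active sets, and the empty one
    yields no normal.\<close>
  then have "10 \<le> num_normals poly y"
    using y card_strict_le[OF y(1)] by simp
  also have "\<dots> \<le> max_normals poly"
    using interior_poly[OF y(1)] by (rule num_normals_le_max_normals)
  finally show ?thesis .
qed

theorem nice_vertex_imp_ten_normals:
  assumes simple: "simple_polytope P"
    and fr: "\<And>V. V extreme_point_of P \<Longrightarrow> vertex_frame P V (fa V) (fe V)"
    and V: "V extreme_point_of P" and X: "nice_dir (fa V) (fe V) X"
  shows "10 \<le> max_normals P"
proof -
  have P: "polytope P"
    using simple by (simp add: simple_polytope_def full_polytope_def)
  have "P \<noteq> {}"
    using V by (auto simp: extreme_point_of_def)
  from simple_polytope_halfspaces[OF P this fr] obtain N b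
    where sh: "simple_halfspaces3 N b" and poly: "simple_halfspaces.poly N b = P"
      and tb: "\<And>V. V extreme_point_of P \<Longrightarrow> simple_halfspaces.tight N b V = range (fa V)"
        "\<And>V i. V extreme_point_of P \<Longrightarrow> b (fa V i) = fa V i \<bullet> V"
    by blast
  show ?thesis
    using simple_halfspaces3.nice_dir_imp_ten_normals[OF sh, unfolded poly, OF _ fr tb V X]
      polytope_imp_compact[OF P] by blast
qed

section \<open>Spherical triangles\<close>

text \<open>Otherwise \<open>X + s *\<^sub>R e\<close>, normalised, would leave \<open>T\<close> for small \<open>s > 0\<close>.\<close>

lemma sph_interior_strict:
  assumes X: "X \<in> sph_interior T" and T: "T \<subseteq> {x. e \<bullet> x \<le> 0}" and e: "e \<noteq> 0"
  shows "e \<bullet> X < 0"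
proof (rule ccontr)
  assume "\<not> e \<bullet> X < 0"
  obtain U where U: "openin (top_of_set S2) U" "X \<in> U" "U \<subseteq> T"
    using X unfolding interior_of_def by blast
  obtain O' where O': "open O'" "U = S2 \<inter> O'"
    using U(1) unfolding openin_open by blast
  have X1: "norm X = 1" "X \<in> O'" "e \<bullet> X = 0"
    using U O' T \<open>\<not> e \<bullet> X < 0\<close> by (auto simp: subset_iff)
  define f where "f s = (1 / norm (X + s *\<^sub>R e)) *\<^sub>R (X + s *\<^sub>R e)" for s
  have nz: "X + s *\<^sub>R e \<noteq> 0" for s
  proof
    assume "X + s *\<^sub>R e = 0"
    then have "X \<bullet> (X + s *\<^sub>R e) = 0"
      by simp
    then have "X \<bullet> X = 0"
      using X1(3) by (simp add: inner_add_right inner_commute)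
    then show False
      using X1(1) by simp
  qed
  have "(f \<longlongrightarrow> (1 / norm (X + 0 *\<^sub>R e)) *\<^sub>R (X + 0 *\<^sub>R e)) (at_right 0)"
    unfolding f_def by (intro tendsto_intros) (use nz[of 0] in simp)
  then have lim: "(f \<longlongrightarrow> X) (at_right 0)"
    using X1(1) by simp
  have "\<forall>\<^sub>F s in at_right 0. f s \<in> O'"
    using topological_tendstoD[OF lim O'(1) X1(2)] .
  then have "\<forall>\<^sub>F s in at_right 0. f s \<in> O' \<and> (0::real) < s"
    using eventually_at_right_less[of "0::real"] by (rule eventually_conj)
  then obtain s :: real where s: "f s \<in> O'" "0 < s"
    using eventually_happens' trivial_limit_at_right_real by blast
  have "f s \<in> S2"
    using nz[of s] by (simp add: f_def)
  then have "e \<bullet> f s \<le> 0"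
    using s(1) O'(2) U(3) T by blast
  moreover have "e \<bullet> f s = (1 / norm (X + s *\<^sub>R e)) * (s * (e \<bullet> e))"
    using X1(3) by (simp add: f_def inner_add_right)
  moreover have "(1 / norm (X + s *\<^sub>R e)) * (s * (e \<bullet> e)) > 0"
    using nz[of s] s(2) e by (intro mult_pos_pos) auto
  ultimately show False
    by simp
qed

text \<open>Duality of simplicial cones: the coefficients of \<open>x\<close> in the
  \<open>a i\<close> are nonnegative exactly when all \<open>x \<bullet> e i\<close> are
  nonpositive.\<close>

lemma convex_cone_hull_frame:
  assumes bi: "biorthogonal a e" and neg: "\<And>i. a i \<bullet> e i < 0"
  shows "convex_cone hull (range a) = {x. \<forall>i. x \<bullet> e i \<le> 0}"
proof
  show "convex_cone hull (range a) \<subseteq> {x. \<forall>i. x \<bullet> e i \<le> 0}"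
  proof (rule hull_minimal)
    have "a i \<bullet> e j \<le> 0" for i j
      using bi[unfolded biorthogonal_def] neg[of i] by (metis less_eq_real_def)
    then show "range a \<subseteq> {x. \<forall>i. x \<bullet> e i \<le> 0}"
      by auto
    have "convex_cone (\<Inter> (range (\<lambda>i. {x. e i \<bullet> x \<le> 0})))"
      by (rule convex_cone_Inter) (auto simp: convex_cone_halfspace_le)
    moreover have "\<Inter> (range (\<lambda>i. {x. e i \<bullet> x \<le> 0})) = {x. \<forall>i. x \<bullet> e i \<le> 0}"
      by (auto simp: inner_commute)
    ultimately show "convex_cone {x. \<forall>i. x \<bullet> e i \<le> 0}"
      by simp
  qed
  show "{x. \<forall>i. x \<bullet> e i \<le> 0} \<subseteq> convex_cone hull (range a)"
  proof clarify
    fix x assume x: "\<forall>i. x \<bullet> e i \<le> 0"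
    have "((x \<bullet> e i) / (a i \<bullet> e i)) *\<^sub>R a i \<in> convex_cone hull (range a)" for i
      using x neg[of i] by (intro convex_cone_hull_mul divide_nonpos_neg) (auto intro: hull_inc)
    then have "(\<Sum>i\<in>UNIV. ((x \<bullet> e i) / (a i \<bullet> e i)) *\<^sub>R a i) \<in> convex_cone hull (range a)"
      unfolding sum_3 by (intro convex_cone_hull_add)
    then show "x \<in> convex_cone hull (range a)"
      using biorthogonal_expansion[OF bi, of x] by simp
  qed
qed

lemma range_3: "range f = {f 1, f 2, f (3 :: 3)}"
  by (simp add: UNIV_3)

lemma sph_triangle_frame:
  assumes "vertex_frame P V a e"
  shows "outer_normal_cone P V \<inter> S2 = sph_triangle (a 1) (a 2) (a 3)"
  using convex_cone_hull_frame[OF vertex_frameD(1,3)[OF assms]] outer_normal_cone_eq[OF assms]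
  by (auto simp: sph_triangle_def range_3)

lemma is_sph_triangle_frame:
  assumes fr: "vertex_frame P V a e"
  shows "is_sph_triangle (a 1) (a 2) (a 3)"
proof -
  note D = vertex_frameD[OF fr]
  \<comment> \<open>Minus the sum of the edge vectors is positive on the nonzero vectors of the
    normal cone, so its direction is the pole of a suitable open hemisphere.\<close>
  define h where "h = - (\<Sum>i\<in>UNIV. e i)"
  have h: "h \<bullet> x > 0" if x: "x \<in> outer_normal_cone P V" "x \<noteq> 0" for x
  proof -
    have le: "x \<bullet> e i \<le> 0" for i
      using x by (simp add: outer_normal_cone_eq[OF fr])
    have "(\<Sum>i\<in>UNIV. - (x \<bullet> e i)) \<noteq> 0"
    proof
      assume "(\<Sum>i\<in>UNIV. - (x \<bullet> e i)) = 0"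
      then have "e i \<bullet> x = 0" for i
        using le by (subst (asm) sum_nonneg_eq_0_iff) (auto simp: inner_commute)
      then show False
        using biorthogonal_eq_0[OF biorthogonal_sym[OF D(1)]] x(2) by blast
    qed
    moreover have "(\<Sum>i\<in>UNIV. - (x \<bullet> e i)) \<ge> 0"
      using le by (intro sum_nonneg) simp
    moreover have "h \<bullet> x = (\<Sum>i\<in>UNIV. - (x \<bullet> e i))"
      by (simp add: h_def inner_sum_left sum_negf inner_commute[of x])
    ultimately show ?thesis
      by simp
  qed
  have a1: "a 1 \<in> outer_normal_cone P V" "a 1 \<noteq> 0"
    using D(4)[of 1] D(6) by (auto simp: outer_normal_cone_def inner_commute)
  have "h \<noteq> 0"
    using h[OF a1] by auto
  have "in_open_hemisphere (sph_triangle (a 1) (a 2) (a 3))"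
    unfolding in_open_hemisphere_def sph_triangle_frame[OF fr, symmetric]
  proof (intro bexI subsetI)
    show "(1 / norm h) *\<^sub>R h \<in> S2"
      using \<open>h \<noteq> 0\<close> by simp
    fix x assume x: "x \<in> outer_normal_cone P V \<inter> S2"
    then have "x \<noteq> 0"
      by auto
    then have "h \<bullet> x > 0"
      using h x by blast
    then show "x \<in> {x \<in> S2. 0 < ((1 / norm h) *\<^sub>R h) \<bullet> x}"
      using x \<open>h \<noteq> 0\<close> by simp
  qed
  then show ?thesis
    using biorthogonal_basis(2,4)[OF D(1)] D(4) unfolding is_sph_triangle_def range_3
    by simp
qed

section \<open>From spherical niceness to inequalities between inner products\<close>

lemma geodesic_segmentE:
  assumes "W \<in> geodesic_segment A B"
  obtains s t where "s \<ge> 0" "t \<ge> 0" "W = s *\<^sub>R A + t *\<^sub>R B" "norm W = 1"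
proof -
  define K where "K = {s *\<^sub>R A + t *\<^sub>R B |s t. 0 \<le> s \<and> 0 \<le> t}"
  have "convex_cone K"
    unfolding convex_cone_iff
  proof (intro conjI ballI allI impI)
    show "0 \<in> K"
      unfolding K_def by (rule CollectI, rule exI[of _ 0], rule exI[of _ 0]) simp
    fix x y assume x: "x \<in> K" and y: "y \<in> K"
    obtain s t where 1: "x = s *\<^sub>R A + t *\<^sub>R B" "0 \<le> s" "0 \<le> t"
      using x by (auto simp: K_def)
    obtain s' t' where 2: "y = s' *\<^sub>R A + t' *\<^sub>R B" "0 \<le> s'" "0 \<le> t'"
      using y by (auto simp: K_def)
    show "x + y \<in> K"
      unfolding K_def using 1 2
      by (intro CollectI exI[of _ "s + s'"] exI[of _ "t + t'"]) (simp add: algebra_simps)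
  next
    fix x and c :: real assume x: "x \<in> K" and c: "0 \<le> c"
    obtain s t where 1: "x = s *\<^sub>R A + t *\<^sub>R B" "0 \<le> s" "0 \<le> t"
      using x by (auto simp: K_def)
    show "c *\<^sub>R x \<in> K"
      unfolding K_def using 1 c
      by (intro CollectI exI[of _ "c * s"] exI[of _ "c * t"]) (simp add: algebra_simps)
  qed
  moreover have "A \<in> K"
    unfolding K_def by (rule CollectI, rule exI[of _ 1], rule exI[of _ 0]) simp
  moreover have "B \<in> K"
    unfolding K_def by (rule CollectI, rule exI[of _ 0], rule exI[of _ 1]) simp
  ultimately have "convex_cone hull {A, B} \<subseteq> K"
    by (intro hull_minimal) auto
  then show ?thesis
    using assms that by (auto simp: geodesic_segment_def K_def)
qed

lemma geodesic_segment_commute: "geodesic_segment A B = geodesic_segment B A"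
  by (simp add: geodesic_segment_def insert_commute)

text \<open>Orthogonality at the foot \<open>W = s A + t B\<close> means that
  \<open>X \<bullet> Z = k * (W \<bullet> Z)\<close> on the segment. Evaluating at both ends gives
  \<open>X \<bullet> B - c * (X \<bullet> A) = k * (t * (1 - c * c))\<close> with
  \<open>c = A \<bullet> B\<close>, and all factors on the right are nonnegative.\<close>

lemma projects_to_imp_inner_le:
  assumes A: "norm A = 1" and B: "norm B = 1" and XA: "0 < X \<bullet> A" and XB: "0 < X \<bullet> B"
    and proj: "projects_to X (geodesic_segment A B)"
  shows "(A \<bullet> B) * (X \<bullet> A) \<le> X \<bullet> B"
proof -
  obtain W where W: "W \<in> geodesic_segment A B"
    and orth: "\<And>Z. Z \<in> geodesic_segment A B \<Longrightarrow> orthogonal (geodesic_dir W X) (geodesic_dir W Z)"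
    using proj unfolding projects_to_def by blast
  obtain s t where st: "s \<ge> 0" "t \<ge> 0" "W = s *\<^sub>R A + t *\<^sub>R B" and W1: "norm W = 1"
    using W by (rule geodesic_segmentE)
  have WW: "W \<bullet> W = 1" and AA: "A \<bullet> A = 1" and BB: "B \<bullet> B = 1"
    using W1 A B by (simp_all add: dot_square_norm)
  define c k where "c = A \<bullet> B" and "k = W \<bullet> X"
  have foot: "X \<bullet> Z = k * (W \<bullet> Z)" if "Z \<in> geodesic_segment A B" for Z
    using orth[OF that] WW
    by (simp add: orthogonal_def geodesic_dir_def inner_diff_left inner_diff_right k_def inner_commute)
  have "A \<in> geodesic_segment A B" "B \<in> geodesic_segment A B"
    using A B by (auto simp: geodesic_segment_def intro: hull_inc)
  note f = this[THEN foot]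
  have "k = s * (X \<bullet> A) + t * (X \<bullet> B)"
    by (simp add: k_def st(3) inner_add_left inner_commute[of X])
  then have k: "k \<ge> 0"
    using st XA XB by simp
  have "\<bar>c\<bar> \<le> 1"
    using Cauchy_Schwarz_ineq2[of A B] A B by (simp add: c_def)
  then have "c * c \<le> 1"
    by (metis abs_mult_self_eq abs_ge_zero mult_le_one)
  then have "0 \<le> k * (t * (1 - c * c))"
    using k st by simp
  also have "\<dots> = X \<bullet> B - c * (X \<bullet> A)"
  proof -
    have "W \<bullet> A = s + t * c" "W \<bullet> B = s * c + t"
      by (simp_all add: st(3) inner_add_left AA BB c_def inner_commute[of B A])
    then show ?thesis
      unfolding f by (simp add: algebra_simps)
  qed
  finally show ?thesis
    by (simp add: c_def)
qed

lemma sdist_less_pi_half: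
  assumes "norm X = 1" "norm A = 1" "sdist X A < pi / 2"
  shows "0 < X \<bullet> A"
proof -
  have "\<bar>X \<bullet> A\<bar> \<le> 1"
    using Cauchy_Schwarz_ineq2[of X A] assms by simp
  then show ?thesis
    using assms(3) arccos_less_mono[of "X \<bullet> A" 0] by (simp add: sdist_def)
qed

text \<open>Adding a small multiple of the point equidistant from the vertices makes all inequalities
  strict at once, because distinct vertices have inner product less than 1.\<close>

lemma nice_imp_nice_dir:
  assumes fr: "vertex_frame P V a e" and nice: "nice (a 1) (a 2) (a 3)"
  shows "\<exists>X. nice_dir a e X"
proof -
  note D = vertex_frameD[OF fr]
  obtain X where X: "X \<in> sph_interior (sph_triangle (a 1) (a 2) (a 3))"
    and proj: "projects_to X (geodesic_segment (a 1) (a 2))"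
      "projects_to X (geodesic_segment (a 2) (a 3))" "projects_to X (geodesic_segment (a 3) (a 1))"
    and dist: "sdist X (a 1) < pi / 2" "sdist X (a 2) < pi / 2" "sdist X (a 3) < pi / 2"
    using nice unfolding nice_def by blast
  have X1: "norm X = 1"
    using X interior_of_subset[of "top_of_set S2"] by (force simp: sph_triangle_def)
  have Xe: "X \<bullet> e i < 0" for i
  proof -
    have "sph_triangle (a 1) (a 2) (a 3) \<subseteq> {x. e i \<bullet> x \<le> 0}"
      unfolding sph_triangle_frame[OF fr, symmetric]
      by (auto simp: outer_normal_cone_eq[OF fr] inner_commute)
    moreover have "e i \<noteq> 0"
      using D(3)[of i] by auto
    ultimately have "e i \<bullet> X < 0"
      by (rule sph_interior_strict[OF X])
    then show ?thesis
      by (simp add: inner_commute)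
  qed
  have Xa: "0 < X \<bullet> a i" for i
    using exhaust_3[of i] dist X1 D(4) sdist_less_pi_half by metis
  have proj_commute: "projects_to X (geodesic_segment (a 2) (a 1))"
    "projects_to X (geodesic_segment (a 3) (a 2))" "projects_to X (geodesic_segment (a 1) (a 3))"
    using proj by (simp_all add: geodesic_segment_commute[of "a 2" "a 1"]
        geodesic_segment_commute[of "a 3" "a 2"] geodesic_segment_commute[of "a 1" "a 3"])
  have proj': "projects_to X (geodesic_segment (a i) (a j))" if "i \<noteq> j" for i j
    using exhaust_3[of i] exhaust_3[of j] that
    by (elim disjE) (simp_all add: proj proj_commute)
  have le: "(a i \<bullet> a j) * (X \<bullet> a i) \<le> X \<bullet> a j" if "i \<noteq> j" for i j
    using projects_to_imp_inner_le[OF D(4) D(4) Xa Xa proj'[OF that]] .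
  have aa: "a i \<bullet> a j < 1" if "i \<noteq> j" for i j
  proof -
    have "a i \<noteq> a j"
      using biorthogonal_basis(1)[OF D(1)] that by (auto dest: injD)
    then have "(a i - a j) \<bullet> (a i - a j) > 0"
      by simp
    moreover have "a i \<bullet> a i = 1" "a j \<bullet> a j = 1"
      using D(4) by (simp_all add: dot_square_norm)
    ultimately show ?thesis
      by (simp add: inner_diff_left inner_diff_right inner_commute)
  qed
  define Y where "Y = (\<Sum>j\<in>UNIV. (1 / (e j \<bullet> a j)) *\<^sub>R e j)"
  have Y: "Y \<bullet> a i = 1" for i
  proof -
    have "Y \<bullet> a i = (\<Sum>j\<in>UNIV. if j = i then 1 else 0)"
      unfolding Y_def inner_sum_left
      using D(1) biorthogonal_sym[OF D(1)] by (intro sum.cong refl) (auto simp: biorthogonal_def)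
    then show ?thesis
      by simp
  qed
  have "\<forall>\<^sub>F s in at_right 0. (X + s *\<^sub>R Y) \<bullet> e i < 0" for i
  proof -
    have "((\<lambda>s. (X + s *\<^sub>R Y) \<bullet> e i) \<longlongrightarrow> (X + 0 *\<^sub>R Y) \<bullet> e i) (at_right 0)"
      by (intro tendsto_intros)
    then show ?thesis
      using Xe[of i] by (intro order_tendstoD(2)) auto
  qed
  then have "\<forall>\<^sub>F s in at_right 0. \<forall>i. (X + s *\<^sub>R Y) \<bullet> e i < 0"
    by (rule eventually_all_finite)
  then have "\<forall>\<^sub>F s in at_right 0. (\<forall>i. (X + s *\<^sub>R Y) \<bullet> e i < 0) \<and> (0::real) < s"
    using eventually_at_right_less[of "0::real"] by (rule eventually_conj)
  then obtain s :: real where s: "\<And>i. (X + s *\<^sub>R Y) \<bullet> e i < 0" "0 < s"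
    using eventually_happens' trivial_limit_at_right_real by blast
  have "nice_dir a e (X + s *\<^sub>R Y)"
    unfolding nice_dir_def
  proof (intro allI conjI impI)
    show "(X + s *\<^sub>R Y) \<bullet> e i < 0" for i
      by (rule s)
    show "0 < (X + s *\<^sub>R Y) \<bullet> a i" for i
      using Xa[of i] s(2) by (simp add: inner_add_left Y)
    show "(a i \<bullet> a j) * ((X + s *\<^sub>R Y) \<bullet> a i) < (X + s *\<^sub>R Y) \<bullet> a j" if "i \<noteq> j" for i j
    proof -
      have "(a i \<bullet> a j) * s < s"
        using aa[OF that] s(2) by simp
      then show ?thesis
        using le[OF that] by (simp add: inner_add_left Y distrib_left)
    qed
  qed
  then show ?thesis
    by blast
qed

text \<open>Every linear functional attains its maximum over \<open>P\<close> at a vertex, which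
  gives the covering. A common interior point \<open>X\<close> of the cones of \<open>V\<close> and
  \<open>W\<close> would make both \<open>(W - V) \<bullet> X\<close> and
  \<open>(V - W) \<bullet> X\<close> negative.\<close>

lemma tiles_sphere_outer_normal_cones:
  assumes P: "polytope P" "P \<noteq> {}"
  shows "tiles_sphere {V. V extreme_point_of P} (\<lambda>V. outer_normal_cone P V \<inter> S2)"
  unfolding tiles_sphere_def
proof (intro conjI)
  have conv: "convex P" and comp: "compact P"
    using P by (auto intro: polytope_imp_convex polytope_imp_compact)
  show "finite {V. V extreme_point_of P}"
    using P(1) by (simp add: finite_polyhedron_extreme_points polytope_imp_polyhedron)
  have "\<exists>V. V extreme_point_of P \<and> x \<in> outer_normal_cone P V" for x
    using exists_extreme_point_maximizing[OF comp conv P(2), of x]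
    by (simp add: outer_normal_cone_def inner_diff_left inner_commute[of _ x])
  then show "(\<Union>V\<in>{V. V extreme_point_of P}. outer_normal_cone P V \<inter> S2) = S2"
    by blast
  show "disjoint_family_on (\<lambda>V. sph_interior (outer_normal_cone P V \<inter> S2)) {V. V extreme_point_of P}"
    unfolding disjoint_family_on_def
  proof (intro ballI impI equals0I)
    fix V W X
    assume V: "V \<in> {V. V extreme_point_of P}" and W: "W \<in> {V. V extreme_point_of P}" and "V \<noteq> W"
      and X: "X \<in> sph_interior (outer_normal_cone P V \<inter> S2) \<inter>
                 sph_interior (outer_normal_cone P W \<inter> S2)"
    have PVW: "V \<in> P" "W \<in> P"
      using V W by (auto simp: extreme_point_of_def)
    have "(q - p) \<bullet> X < 0"
      if "X \<in> sph_interior (outer_normal_cone P p \<inter> S2)" "q \<in> P" "p \<noteq> q" for p q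
      using that(2,3) by (intro sph_interior_strict[OF that(1)]) (auto simp: outer_normal_cone_def)
    then have "(W - V) \<bullet> X < 0" "(V - W) \<bullet> X < 0"
      using X PVW \<open>V \<noteq> W\<close> by auto
    then show False
      by (simp add: inner_diff_left)
  qed
qed

theorem corollary3:
  fixes P :: "(real^3) set"
  assumes "simple_polytope P" and "generic_polytope P" and "max_normals P < 10"
  shows "tiles_sphere {V. V extreme_point_of P} (\<lambda>V. outer_normal_cone P V \<inter> S2) \<and>
         (\<forall>V. V extreme_point_of P \<longrightarrow> skew_sph_triangle (outer_normal_cone P V \<inter> S2))"
proof (intro conjI allI impI)
  have "polytope P" "P \<noteq> {}"
    using assms(1) by (auto simp: simple_polytope_def full_polytope_def)
  then show "tiles_sphere {V. V extreme_point_of P} (\<lambda>V. outer_normal_cone P V \<inter> S2)"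
    by (rule tiles_sphere_outer_normal_cones)
  have "\<forall>V. \<exists>a e. V extreme_point_of P \<longrightarrow> vertex_frame P V a e"
    using exists_vertex_frame[OF assms(1)] by blast
  then obtain fa fe where fr: "\<And>V. V extreme_point_of P \<Longrightarrow> vertex_frame P V (fa V) (fe V)"
    by metis
  fix V assume V: "V extreme_point_of P"
  have "\<not> nice (fa V 1) (fa V 2) (fa V 3)"
  proof
    assume "nice (fa V 1) (fa V 2) (fa V 3)"
    then obtain X where "nice_dir (fa V) (fe V) X"
      using nice_imp_nice_dir[OF fr[OF V]] by blast
    from nice_vertex_imp_ten_normals[OF assms(1) fr V this] assms(3) show False
      by simp
  qed
  then show "skew_sph_triangle (outer_normal_cone P V \<inter> S2)"
    unfolding skew_sph_triangle_def
    using is_sph_triangle_frame[OF fr[OF V]] sph_triangle_frame[OF fr[OF V]] by blast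
qed

end
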